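(* Let $(\Sigma,\mathscr{C},(-)^\sigma,(-)^+)$ be a canonicity framework in which $\Sigma$ is a class of first-order structures of a fixed signature (with the usual ultraproducts), and let $\mathcal{S}\subseteq\Sigma$ be closed under ultraproducts. Let $\mathcal{S}_{\mathrm{el}}$ be the smallest elementary (first-order axiomatisable) class containing $\mathcal{S}$, and assume $\mathcal{S}_{\mathrm{el}}\subseteq\Sigma$ and that isomorphic structures in $\Sigma$ have isomorphic algebras under $(-)^+$. Then $\mathbf{HSP}\,\mathcal{S}^+=\mathbf{HSP}\,\mathcal{S}_{\mathrm{el}}^{\ +}$, where $\mathcal{K}^+=\{P^+:P\in\mathcal{K}\}$.
   Context: Write $\mathbb{A}\rightarrowtail\mathbb{B}$ if there is an injective homomorphism from $\mathbb{A}$ to $\mathbb{B}$, and $\mathbb{A}\twoheadrightarrow\mathbb{B}$ if there is a surjective one. A canonicity framework consists of: a class $\Sigma$ of structures closed under ultraproducts; a variety $\mathscr{C}$ of algebras; an operation $(-)^\sigma\colon\mathscr{C}\to\mathscr{C}$; and an operation $(-)^+\colon\Sigma\to\mathscr{C}$; such that for all $\mathbb{A},\mathbb{B}\in\mathscr{C}$, all families $\{P_i:i\in I\}\subseteq\Sigma$ and all $P\in\Sigma$: (A1) $\mathbb{A}\rightarrowtail\mathbb{B}$ implies $\mathbb{A}^\sigma\rightarrowtail\mathbb{B}^\sigma$, and $\mathbb{A}\twoheadrightarrow\mathbb{B}$ implies $\mathbb{A}^\sigma\twoheadrightarrow\mathbb{B}^\sigma$; (A2) $\prod_U(P_i^+)\rightarrowtail(\prod_U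 P_i)^+$ for every ultrafilter $U$ on $I$; (A3) there is an ultrafilter $U$ with $(P^+)^\sigma\rightarrowtail(P^U)^+$; (A4) $(\prod_I P_i^+)^\sigma\rightarrowtail\prod_{U\in\beta I}(\prod_U P_i^+)^\sigma$, $\beta I$ the set of ultrafilters on $I$. $\mathbf{HSP}\,\mathcal{K}$ is the variety generated by a class $\mathcal{K}$ of algebras. *)

theory Defs
  imports "HOL-Library.FuncSet"
begin

section \<open>The set-theoretic universe\<close>

text \<open>
  A type of this class is a model of second-order ZFC (choice is inherited from HOL), in the
  style of the type of sets in the AFP entry ZFC-in-HOL. Its elements are the sets and its HOL
  subsets are the classes. The class has no instance definable in HOL; it is a way of
  speaking about proper classes of structures closed under ultraproducts of arbitrary size.
\<close>

class zf_universe =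
  fixes elts :: "'a \<Rightarrow> 'a set"
  assumes extensionality: "elts x = elts y \<Longrightarrow> x = y"
    and foundation: "wf {(x, y). x \<in> elts y}"
    and separation: "A \<subseteq> elts x \<Longrightarrow> A \<in> range elts"
    and replacement: "f ` elts x \<in> range elts"
    and union: "\<Union> (elts ` elts x) \<in> range elts"
    and power: "{y. elts y \<subseteq> elts x} \<in> range elts"
    and infinity: "\<exists>x. infinite (elts x)"

definition vset :: "'v::zf_universe set \<Rightarrow> 'v" where
  "vset A = (THE x. elts x = A)"

definition vpair :: "'v::zf_universe \<Rightarrow> 'v \<Rightarrow> 'v" where
  "vpair a b = vset {vset {a}, vset {a, b}}"

text \<open>The graph of a function on the set \<open>I\<close>, and application of such a graph.\<close>

definition vfun :: "'v::zf_universe \<Rightarrow> ('v \<Rightarrow> 'v) \<Rightarrow> 'v" where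
  "vfun I f = vset ((\<lambda>i. vpair i (f i)) ` elts I)"

definition vapp :: "'v::zf_universe \<Rightarrow> 'v \<Rightarrow> 'v" where
  "vapp z i = (THE y. vpair i y \<in> elts z)"

definition tuples :: "'v::zf_universe \<Rightarrow> nat \<Rightarrow> 'v list set" where
  "tuples A n = {xs. set xs \<subseteq> elts A \<and> length xs = n}"

lemma elts_vset: "A \<in> range elts \<Longrightarrow> elts (vset A) = A"
  unfolding vset_def by (metis (mono_tags, lifting) extensionality rangeE theI)

lemma vset_elts [simp]: "vset (elts x) = x"
  by (rule extensionality) (simp add: elts_vset)


section \<open>Signatures, structures and algebras\<close>

text \<open>
  The symbols of a signature form sets. Constants are function symbols of arity 0.
  The arity functions matter only on the symbols of the signature.
\<close>

record 'v signature =
  fsyms :: 'v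
  farity :: "'v \<Rightarrow> nat"
  rsyms :: 'v
  rarity :: "'v \<Rightarrow> nat"

record 'v struc =
  carr :: 'v
  fn :: "'v \<Rightarrow> 'v list \<Rightarrow> 'v"
  rl :: "'v \<Rightarrow> 'v list set"

text \<open>
  Structures have a nonempty carrier. The interpretations are fixed outside their
  domains, so that equality of records is equality of structures.
\<close>

definition is_structure :: "'v::zf_universe signature \<Rightarrow> 'v struc \<Rightarrow> bool" where
  "is_structure L P \<longleftrightarrow>
     elts (carr P) \<noteq> {} \<and>
     (\<forall>f xs. if f \<in> elts (fsyms L) \<and> xs \<in> tuples (carr P) (farity L f)
             then fn P f xs \<in> elts (carr P) else fn P f xs = undefined) \<and>
     (\<forall>r. if r \<in> elts (rsyms L) then rl P r \<subseteq> tuples (carr P) (rarity L r)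
          else rl P r = {})"

text \<open>Algebras are the structures of a signature without relation symbols.\<close>

definition algebraic :: "'v::zf_universe signature \<Rightarrow> bool" where
  "algebraic F \<longleftrightarrow> elts (rsyms F) = {}"

definition hom :: "'v::zf_universe signature \<Rightarrow> 'v struc \<Rightarrow> 'v struc \<Rightarrow> ('v \<Rightarrow> 'v) set" where
  "hom L A B = {h \<in> elts (carr A) \<rightarrow> elts (carr B).
     (\<forall>f\<in>elts (fsyms L). \<forall>xs\<in>tuples (carr A) (farity L f). h (fn A f xs) = fn B f (map h xs)) \<and>
     (\<forall>r\<in>elts (rsyms L). \<forall>xs\<in>rl A r. map h xs \<in> rl B r)}"

definition inj_hom :: "'v::zf_universe signature \<Rightarrow> 'v struc \<Rightarrow> 'v struc \<Rightarrow> bool" where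
  "inj_hom L A B \<longleftrightarrow> (\<exists>h\<in>hom L A B. inj_on h (elts (carr A)))"

definition surj_hom :: "'v::zf_universe signature \<Rightarrow> 'v struc \<Rightarrow> 'v struc \<Rightarrow> bool" where
  "surj_hom L A B \<longleftrightarrow> (\<exists>h\<in>hom L A B. h ` elts (carr A) = elts (carr B))"

definition isomorphic :: "'v::zf_universe signature \<Rightarrow> 'v struc \<Rightarrow> 'v struc \<Rightarrow> bool" where
  "isomorphic L A B \<longleftrightarrow>
     (\<exists>h\<in>hom L A B. bij_betw h (elts (carr A)) (elts (carr B)) \<and>
                    inv_into (elts (carr A)) h \<in> hom L B A)"

definition subalgebra :: "'v::zf_universe signature \<Rightarrow> 'v struc \<Rightarrow> 'v struc \<Rightarrow> bool" where
  "subalgebra F A B \<longleftrightarrow>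
     elts (carr A) \<subseteq> elts (carr B) \<and>
     (\<forall>f\<in>elts (fsyms F). \<forall>xs\<in>tuples (carr A) (farity F f). fn A f xs = fn B f xs)"


section \<open>Direct products and ultraproducts\<close>

definition product :: "'v::zf_universe signature \<Rightarrow> 'v \<Rightarrow> ('v \<Rightarrow> 'v struc) \<Rightarrow> 'v struc" where
  "product L I P =
     (let D = vset (vfun I ` (\<Pi>\<^sub>E i\<in>elts I. elts (carr (P i)))) in
      \<lparr> carr = D,
        fn = (\<lambda>f xs. if f \<in> elts (fsyms L) \<and> xs \<in> tuples D (farity L f)
                     then vfun I (\<lambda>i. fn (P i) f (map (\<lambda>x. vapp x i) xs)) else undefined),
        rl = (\<lambda>r. if r \<in> elts (rsyms L)
                  then {xs \<in> tuples D (rarity L r). \<forall>i\<in>elts I. map (\<lambda>x. vapp x i) xs \<in> rl (P i) r}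
                  else {}) \<rparr>)"

definition ultrafilter :: "'v::zf_universe \<Rightarrow> 'v \<Rightarrow> bool" where
  "ultrafilter I U \<longleftrightarrow>
     (\<forall>X\<in>elts ` elts U. X \<subseteq> elts I) \<and>
     elts I \<in> elts ` elts U \<and>
     {} \<notin> elts ` elts U \<and>
     (\<forall>X\<in>elts ` elts U. \<forall>Y\<in>elts ` elts U. X \<inter> Y \<in> elts ` elts U) \<and>
     (\<forall>X\<in>elts ` elts U. \<forall>Y. X \<subseteq> Y \<and> Y \<subseteq> elts I \<longrightarrow> Y \<in> elts ` elts U) \<and>
     (\<forall>X. X \<subseteq> elts I \<longrightarrow> X \<in> elts ` elts U \<or> elts I - X \<in> elts ` elts U)"

definition ultrafilters :: "'v::zf_universe \<Rightarrow> 'v" where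
  "ultrafilters I = vset {U. ultrafilter I U}"

text \<open>
  The equivalence class of \<open>z\<close> in the carrier of the direct product, modulo equality on a
  member of \<open>U\<close>, and a representative of such a class (any choice gives the same ultraproduct).
\<close>

definition uclass :: "'v::zf_universe signature \<Rightarrow> 'v \<Rightarrow> 'v \<Rightarrow> ('v \<Rightarrow> 'v struc) \<Rightarrow> 'v \<Rightarrow> 'v" where
  "uclass L I U P z =
     vset {w \<in> elts (carr (product L I P)). {i \<in> elts I. vapp z i = vapp w i} \<in> elts ` elts U}"

definition urep :: "'v::zf_universe \<Rightarrow> 'v" where
  "urep c = (SOME z. z \<in> elts c)"

definition ultraproduct :: "'v::zf_universe signature \<Rightarrow> 'v \<Rightarrow> 'v \<Rightarrow> ('v \<Rightarrow> 'v struc) \<Rightarrow> 'v struc" where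
  "ultraproduct L I U P =
     (let D = vset (uclass L I U P ` elts (carr (product L I P))) in
      \<lparr> carr = D,
        fn = (\<lambda>f cs. if f \<in> elts (fsyms L) \<and> cs \<in> tuples D (farity L f)
                     then uclass L I U P (fn (product L I P) f (map urep cs)) else undefined),
        rl = (\<lambda>r. if r \<in> elts (rsyms L)
                  then {cs \<in> tuples D (rarity L r).
                          {i \<in> elts I. map (\<lambda>c. vapp (urep c) i) cs \<in> rl (P i) r} \<in> elts ` elts U}
                  else {}) \<rparr>)"

definition ultraproduct_closed :: "'v::zf_universe signature \<Rightarrow> 'v struc set \<Rightarrow> bool" where
  "ultraproduct_closed L K \<longleftrightarrow>
     (\<forall>I U P. ultrafilter I U \<and> (\<forall>i\<in>elts I. P i \<in> K) \<longrightarrow> ultraproduct L I U P \<in> K)"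


section \<open>Varieties\<close>

definition opH :: "'v::zf_universe signature \<Rightarrow> 'v struc set \<Rightarrow> 'v struc set" where
  "opH F K = {A. is_structure F A \<and> (\<exists>B\<in>K. surj_hom F B A)}"

definition opS :: "'v::zf_universe signature \<Rightarrow> 'v struc set \<Rightarrow> 'v struc set" where
  "opS F K = {A. is_structure F A \<and> (\<exists>B\<in>K. subalgebra F A B)}"

definition opP :: "'v::zf_universe signature \<Rightarrow> 'v struc set \<Rightarrow> 'v struc set" where
  "opP F K = {product F I A |I A. \<forall>i\<in>elts I. A i \<in> K}"

definition HSP :: "'v::zf_universe signature \<Rightarrow> 'v struc set \<Rightarrow> 'v struc set" where
  "HSP F K = opH F (opS F (opP F K))"

definition variety :: "'v::zf_universe signature \<Rightarrow> 'v struc set \<Rightarrow> bool" where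
  "variety F C \<longleftrightarrow> algebraic F \<and> C \<subseteq> Collect (is_structure F) \<and>
     opH F C \<subseteq> C \<and> opS F C \<subseteq> C \<and> opP F C \<subseteq> C"


section \<open>First-order logic and elementary classes\<close>

datatype 'v trm = Var nat | App 'v "'v trm list"

datatype 'v fm =
    Eq "'v trm" "'v trm"
  | Rel 'v "'v trm list"
  | Neg "'v fm"
  | Conj "'v fm" "'v fm"
  | Ex nat "'v fm"

primrec wf_trm :: "'v::zf_universe signature \<Rightarrow> 'v trm \<Rightarrow> bool" where
  "wf_trm L (Var x) \<longleftrightarrow> True"
| "wf_trm L (App f ts) \<longleftrightarrow>
     f \<in> elts (fsyms L) \<and> length ts = farity L f \<and> list_all (\<lambda>b. b) (map (wf_trm L) ts)"

primrec wf_fm :: "'v::zf_universe signature \<Rightarrow> 'v fm \<Rightarrow> bool" where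
  "wf_fm L (Eq s t) \<longleftrightarrow> wf_trm L s \<and> wf_trm L t"
| "wf_fm L (Rel r ts) \<longleftrightarrow>
     r \<in> elts (rsyms L) \<and> length ts = rarity L r \<and> list_all (wf_trm L) ts"
| "wf_fm L (Neg p) \<longleftrightarrow> wf_fm L p"
| "wf_fm L (Conj p q) \<longleftrightarrow> wf_fm L p \<and> wf_fm L q"
| "wf_fm L (Ex x p) \<longleftrightarrow> wf_fm L p"

primrec fv_trm :: "'v trm \<Rightarrow> nat set" where
  "fv_trm (Var x) = {x}"
| "fv_trm (App f ts) = \<Union> (set (map fv_trm ts))"

primrec fv :: "'v fm \<Rightarrow> nat set" where
  "fv (Eq s t) = fv_trm s \<union> fv_trm t"
| "fv (Rel r ts) = \<Union> (set (map fv_trm ts))"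
| "fv (Neg p) = fv p"
| "fv (Conj p q) = fv p \<union> fv q"
| "fv (Ex x p) = fv p - {x}"

definition sentence :: "'v::zf_universe signature \<Rightarrow> 'v fm \<Rightarrow> bool" where
  "sentence L p \<longleftrightarrow> wf_fm L p \<and> fv p = {}"

primrec eval_trm :: "'v struc \<Rightarrow> (nat \<Rightarrow> 'v) \<Rightarrow> 'v trm \<Rightarrow> 'v" where
  "eval_trm P e (Var x) = e x"
| "eval_trm P e (App f ts) = fn P f (map (eval_trm P e) ts)"

primrec sat :: "'v::zf_universe struc \<Rightarrow> (nat \<Rightarrow> 'v) \<Rightarrow> 'v fm \<Rightarrow> bool" where
  "sat P e (Eq s t) \<longleftrightarrow> eval_trm P e s = eval_trm P e t"
| "sat P e (Rel r ts) \<longleftrightarrow> map (eval_trm P e) ts \<in> rl P r"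
| "sat P e (Neg p) \<longleftrightarrow> \<not> sat P e p"
| "sat P e (Conj p q) \<longleftrightarrow> sat P e p \<and> sat P e q"
| "sat P e (Ex x p) \<longleftrightarrow> (\<exists>a\<in>elts (carr P). sat P (e(x := a)) p)"

definition models :: "'v::zf_universe struc \<Rightarrow> 'v fm \<Rightarrow> bool" where
  "models P p \<longleftrightarrow> (\<forall>e. range e \<subseteq> elts (carr P) \<longrightarrow> sat P e p)"

definition Mod :: "'v::zf_universe signature \<Rightarrow> 'v fm set \<Rightarrow> 'v struc set" where
  "Mod L T = {P. is_structure L P \<and> (\<forall>p\<in>T. models P p)}"

definition elementary_class :: "'v::zf_universe signature \<Rightarrow> 'v struc set \<Rightarrow> bool" where
  "elementary_class L K \<longleftrightarrow> (\<exists>T. (\<forall>p\<in>T. sentence L p) \<and> K = Mod L T)"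

definition elementary_hull :: "'v::zf_universe signature \<Rightarrow> 'v struc set \<Rightarrow> 'v struc set" where
  "elementary_hull L S = \<Inter> {K. elementary_class L K \<and> S \<subseteq> K}"

lemma elementary_hull_subset: "S \<subseteq> elementary_hull L S"
  unfolding elementary_hull_def by blast

lemma elementary_hull_least:
  "elementary_class L K \<Longrightarrow> S \<subseteq> K \<Longrightarrow> elementary_hull L S \<subseteq> K"
  unfolding elementary_hull_def by blast

lemma elementary_class_hull:
  assumes "S \<subseteq> Collect (is_structure L)"
  shows "elementary_class L (elementary_hull L S)"
proof -
  define T where "T = {p. sentence L p \<and> (\<forall>P\<in>S. models P p)}"
  have M: "elementary_class L (Mod L T)"
    unfolding elementary_class_def by (rule exI[of _ T]) (simp add: T_def)
  have S: "S \<subseteq> Mod L T"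
    using assms by (auto simp: T_def Mod_def)
  have "Mod L T \<subseteq> K" if "K \<in> {K. elementary_class L K \<and> S \<subseteq> K}" for K
  proof -
    from that obtain T' where T': "\<forall>p\<in>T'. sentence L p" "K = Mod L T'" "S \<subseteq> Mod L T'"
      unfolding elementary_class_def by auto
    have "T' \<subseteq> T"
    proof
      fix p assume "p \<in> T'"
      with T' show "p \<in> T" by (auto simp: T_def Mod_def)
    qed
    then show ?thesis by (auto simp: T'(2) Mod_def)
  qed
  then have "Mod L T \<subseteq> elementary_hull L S"
    unfolding elementary_hull_def by (rule Inter_greatest)
  with elementary_hull_least[OF M S] have "elementary_hull L S = Mod L T" by (rule equalityI)
  with M show ?thesis by simp
qed


section \<open>Canonicity frameworks\<close>

locale canonicity_framework =
  fixes L :: "'v::zf_universe signature"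
    and Sig :: "'v struc set"
    and F :: "'v signature"
    and C :: "'v struc set"
    and sigma :: "'v struc \<Rightarrow> 'v struc"
    and plus :: "'v struc \<Rightarrow> 'v struc"
  assumes Sig_structures: "Sig \<subseteq> Collect (is_structure L)"
    and Sig_ultraproducts: "ultraproduct_closed L Sig"
    and C_variety: "variety F C"
    and sigma_closed: "sigma \<in> C \<rightarrow> C"
    and plus_closed: "plus \<in> Sig \<rightarrow> C"
    and A1_inj: "\<And>A B. A \<in> C \<Longrightarrow> B \<in> C \<Longrightarrow> inj_hom F A B \<Longrightarrow> inj_hom F (sigma A) (sigma B)"
    and A1_surj: "\<And>A B. A \<in> C \<Longrightarrow> B \<in> C \<Longrightarrow> surj_hom F A B \<Longrightarrow> surj_hom F (sigma A) (sigma B)"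
    and A2: "\<And>I P U. (\<forall>i\<in>elts I. P i \<in> Sig) \<Longrightarrow> ultrafilter I U \<Longrightarrow>
       inj_hom F (ultraproduct F I U (\<lambda>i. plus (P i))) (plus (ultraproduct L I U P))"
    and A3: "\<And>P. P \<in> Sig \<Longrightarrow>
       \<exists>I U. ultrafilter I U \<and> inj_hom F (sigma (plus P)) (plus (ultraproduct L I U (\<lambda>_. P)))"
    and A4: "\<And>I P. (\<forall>i\<in>elts I. P i \<in> Sig) \<Longrightarrow>
       inj_hom F (sigma (product F I (\<lambda>i. plus (P i))))
         (product F (ultrafilters I) (\<lambda>U. sigma (ultraproduct F I U (\<lambda>i. plus (P i)))))"

end

theory Submission
  imports Defs "HOL-Library.Equipollence"
begin

text \<open>
  A structure \<open>P\<close> in the elementary hull of \<open>S\<close> has an ultrapower isomorphic to an ultraproduct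
  \<open>Q\<close> of members of \<open>S\<close> (a form of the Keisler--Shelah theorem). Hence \<open>P\<^sup>+\<close> embeds into its
  ultrapower, by (A2) into \<open>(P\<^sup>U)\<^sup>+\<close>, and so into \<open>Q\<^sup>+\<close>, where \<open>Q\<close> lies in \<open>S\<close>.

  The isomorphism is built by Shelah's method, which avoids the continuum hypothesis. Over an
  index set of size \<open>2 ^ \<kappa>\<close> there are \<open>2 ^ (2 ^ \<kappa>)\<close> functions into \<open>\<kappa>\<close> such that any \<open>\<kappa>\<close> many of
  them take prescribed values at a common index. Elements of the two direct products are matched
  in \<open>2 ^ (2 ^ \<kappa>)\<close> steps, the partner of a new element being read off from a function not yet
  used. The requirement that the matching preserves winning positions of finite back-and-forth
  games generates a filter, and every ultrafilter extending it makes the ultraproducts isomorphic.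
\<close>

section \<open>Cardinality and independent functions\<close>

text \<open>Membership of \<open>P\<close> in the hull says only that each sentence true in
  \<open>P\<close> holds in some member of \<open>S\<close>, and different sentences may need
  different members. So the ultrapower is compared with an ultraproduct of varying members, one for
  each game length and finite reduct. Finite reducts are taken because the signature may be
  arbitrarily large, while finitely many formulas decide a game only over finitely many symbols. The
  cardinals are balanced: \<open>\<kappa>\<close> bounds all carriers and the number of kinds of
  game, so products over \<open>2 ^ \<kappa>\<close> indices have at most
  \<open>2 ^ (2 ^ \<kappa>)\<close> elements, as many as there are functions, and each stage of the
  matching has fewer predecessors than that. The obstacle is to keep the choices jointly consistent.
  The invariant is that every finite part of the matching is a winning position at some index, even
  after values there are prescribed for \<open>\<kappa>\<close> many functions not yet spoiled.
  Adding a pair costs one move, so the invariant has to hold for all finite lengths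
  simultaneously.\<close>

lemma lepoll_iff_card_of: "A \<lesssim> B \<longleftrightarrow> ordLeq3 (card_of A) (card_of B)"
  by (simp add: lepoll_def card_of_ordLeq)

lemma not_lepoll_imp_lepoll: "\<not> A \<lesssim> B \<Longrightarrow> B \<lesssim> A"
  unfolding lepoll_iff_card_of
  by (meson card_of_Well_order ordLeq_total)

lemma UN_lepoll_infinite:
  assumes "infinite B" "I \<lesssim> B" "\<And>i. i \<in> I \<Longrightarrow> A i \<lesssim> B"
  shows "(\<Union>i\<in>I. A i) \<lesssim> B"
  using assms card_of_UNION_ordLeq_infinite[of B I A] by (auto simp: lepoll_iff_card_of)

lemma times_lepoll_infinite:
  assumes "infinite C" "A \<lesssim> C" "B \<lesssim> C"
  shows "A \<times> B \<lesssim> C"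
  using assms card_of_Sigma_ordLeq_infinite[of C A "\<lambda>_. B"] by (auto simp: lepoll_iff_card_of)

lemma Un_lepoll_infinite:
  assumes "infinite C" "A \<lesssim> C" "B \<lesssim> C"
  shows "A \<union> B \<lesssim> C"
proof -
  have "(\<Union>i\<in>{True, False}. if i then A else B) \<lesssim> C"
    using assms by (intro UN_lepoll_infinite) (auto intro: finite_lepoll_infinite)
  then show ?thesis by (simp add: Un_commute)
qed

text \<open>A set of size \<open>Suc n\<close> arises from one of size \<open>n\<close> by inserting
  a point, so each size contributes at most \<open>A\<close> many sets. This lets one stage of the
  matching treat all finite sets of earlier tasks together.\<close>

lemma Fpow_lepoll_infinite:
  assumes "infinite A"
  shows "Fpow A \<lesssim> A"
proof -
  have *: "{X \<in> Fpow A. card X = n} \<lesssim> A" for n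
  proof (induction n)
    case 0
    have "{X \<in> Fpow A. card X = 0} \<subseteq> {{}}" by (auto simp: Fpow_def)
    then have "finite {X \<in> Fpow A. card X = 0}" by (rule finite_subset) simp
    with assms show ?case by (rule finite_lepoll_infinite)
  next
    case (Suc n)
    have "{X \<in> Fpow A. card X = Suc n} \<subseteq> (\<lambda>(a, X). insert a X) ` (A \<times> {X \<in> Fpow A. card X = n})"
    proof
      fix X assume "X \<in> {X \<in> Fpow A. card X = Suc n}"
      then have X: "X \<subseteq> A" "finite X" "card X = Suc n" by (auto simp: Fpow_def)
      then obtain a Y where "X = insert a Y" "a \<notin> Y" "card Y = n" by (auto simp: card_Suc_eq)
      with X show "X \<in> (\<lambda>(a, X). insert a X) ` (A \<times> {X \<in> Fpow A. card X = n})"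
        by (intro image_eqI[of _ _ "(a, Y)"]) (auto simp: Fpow_def)
    qed
    then have "{X \<in> Fpow A. card X = Suc n} \<lesssim> A \<times> {X \<in> Fpow A. card X = n}"
      by (rule subset_image_lepoll)
    also have "\<dots> \<lesssim> A" using assms Suc by (intro times_lepoll_infinite) auto
    finally show ?case .
  qed
  have "Fpow A = (\<Union>n\<in>(UNIV::nat set). {X \<in> Fpow A. card X = n})" by auto
  also have "\<dots> \<lesssim> A" using assms * by (intro UN_lepoll_infinite) (auto simp: infinite_le_lepoll)
  finally show ?thesis .
qed

lemma infinite_Plus_lepoll:
  assumes "infinite C" "A \<lesssim> C" "B \<lesssim> C"
  shows "A <+> B \<lesssim> C"
  unfolding Plus_def
  by (rule Un_lepoll_infinite) (use assms in \<open>auto intro: lepoll_trans[OF image_lepoll]\<close>)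

lemma Pow_lepoll_mono:
  assumes "A \<lesssim> B"
  shows "Pow A \<lesssim> Pow B"
proof -
  obtain f where "inj_on f A" "f ` A \<subseteq> B" using assms by (auto simp: lepoll_def)
  then have "inj_on (image f) (Pow A)" "image f ` Pow A \<subseteq> Pow B"
    by (auto intro: inj_on_image_Pow)
  then show ?thesis unfolding lepoll_def by (intro exI conjI)
qed

text \<open>Functions are replaced by their graphs, which are subsets of
  \<open>X \<times> K\<close>. With the index set for \<open>X\<close>, this bounds the number of
  elements of a direct product, hence the number of tasks.\<close>

lemma PiE_lepoll_Pow:
  assumes K: "infinite X" "K \<lesssim> X" and B: "\<And>i. i \<in> X \<Longrightarrow> B i \<lesssim> K"
  shows "(\<Pi>\<^sub>E i\<in>X. B i) \<lesssim> Pow X"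
proof -
  have "(\<Pi>\<^sub>E i\<in>X. B i) \<lesssim> (X \<rightarrow>\<^sub>E K)" using B by (rule lepoll_PiE)
  also have "\<dots> \<lesssim> Pow (X \<times> K)"
  proof -
    let ?g = "\<lambda>f. (\<lambda>x. (x, f x)) ` X"
    have "inj_on ?g (X \<rightarrow>\<^sub>E K)"
    proof (rule inj_onI)
      fix f g assume fg: "f \<in> X \<rightarrow>\<^sub>E K" "g \<in> X \<rightarrow>\<^sub>E K" "?g f = ?g g"
      show "f = g"
      proof (rule PiE_ext[OF fg(1,2)])
        fix x assume "x \<in> X"
        then have "(x, f x) \<in> ?g g" using fg(3) by blast
        then show "f x = g x" by auto
      qed
    qed
    moreover have "?g ` (X \<rightarrow>\<^sub>E K) \<subseteq> Pow (X \<times> K)" by auto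
    ultimately show ?thesis unfolding lepoll_def by (intro exI conjI)
  qed
  also have "\<dots> \<lesssim> Pow X" using K by (intro Pow_lepoll_mono times_lepoll_infinite) auto
  finally show ?thesis .
qed

text \<open>The enumeration takes values in \<open>D\<close> outside \<open>K\<close> as well. This
  matters later, when it is applied to values of \<open>ind\<close>, which may fall outside
  \<open>K\<close> at indices where nothing was prescribed.\<close>

lemma lepoll_imp_surj:
  assumes "D \<lesssim> K" "D \<noteq> {}"
  shows "\<exists>s. s ` K = D \<and> range s \<subseteq> D"
proof -
  obtain g where g: "D \<subseteq> g ` K" using assms(1) by (auto simp: lepoll_iff)
  obtain d where d: "d \<in> D" using assms(2) by auto
  have "(\<lambda>k. if g k \<in> D then g k else d) ` K = D" using g d by fastforce
  moreover have "range (\<lambda>k. if g k \<in> D then g k else d) \<subseteq> D" using d by auto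
  ultimately show ?thesis by blast
qed

section \<open>Independent functions and disjoint conflicts\<close>

text \<open>
  An index \<open>\<xi>\<close> codes, through \<open>enc\<close>, sequences of length \<open>K\<close>: subsets \<open>w l\<close> of \<open>K\<close>, traces, and
  values. The function belonging to \<open>X\<close> returns the value at the position whose trace is
  \<open>{l. w l \<in> X}\<close>; so \<open>\<xi>\<close> meets the conditions once the \<open>w l\<close> separate the given sets \<open>X\<close>.
\<close>

lemma independent_family:
  assumes K: "infinite (K::'k set)"
  obtains ind :: "'k set set \<Rightarrow> 'k set \<Rightarrow> 'k" where
    "\<And>D p. D \<subseteq> Pow (Pow K) \<Longrightarrow> D \<lesssim> K \<Longrightarrow> p \<in> D \<rightarrow> K \<Longrightarrow>
       \<exists>\<xi>\<in>Pow K. \<forall>X\<in>D. ind X \<xi> = p X"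
proof -
  have "K \<times> K \<times> K \<lesssim> K" using K by (intro times_lepoll_infinite) auto
  then obtain enc where enc: "inj_on enc (K \<times> K \<times> K)" "enc ` (K \<times> K \<times> K) \<subseteq> K"
    by (auto simp: lepoll_def)
  obtain T where T: "finite T" "card T = 3" "T \<subseteq> K"
    using infinite_arbitrarily_large[OF K] by blast
  then obtain t0 t1 t2 where t: "t0 \<in> K" "t1 \<in> K" "t2 \<in> K" "t0 \<noteq> t1" "t0 \<noteq> t2" "t1 \<noteq> t2"
    by (auto simp: card_3_iff)
  \<comment> \<open>The tags \<open>t0\<close>, \<open>t1\<close>, \<open>t2\<close> pack three
    sequences of subsets of \<open>K\<close> into one set \<open>\<xi>\<close>: the sets
    \<open>w k\<close>, the traces, and the values as singletons.\<close>
  define dec where "dec t \<xi> k = {l \<in> K. enc (t, k, l) \<in> \<xi>}" for t \<xi> k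
  define ind where "ind X \<xi> =
    (SOME l. l \<in> dec t2 \<xi> (SOME k. k \<in> K \<and> {l \<in> K. dec t0 \<xi> l \<in> X} = dec t1 \<xi> k))" for X \<xi>
  show ?thesis
  proof (rule that)
    fix D p assume D: "D \<subseteq> Pow (Pow K)" "D \<lesssim> K" "p \<in> D \<rightarrow> K"
    show "\<exists>\<xi>\<in>Pow K. \<forall>X\<in>D. ind X \<xi> = p X"
    proof (cases "D = {}")
      case False
      with D obtain s where s: "s ` K = D" using lepoll_imp_surj[of D K] by blast
      define sep where "sep X Y = (SOME x. x \<in> X - Y \<union> (Y - X))" for X Y :: "'k set set"
      have sep: "sep X Y \<in> X - Y \<union> (Y - X)" if "X \<noteq> Y" for X Y
      proof -
        have "\<exists>x. x \<in> X - Y \<union> (Y - X)" using that by blast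
        then show ?thesis unfolding sep_def by (rule someI_ex)
      qed
      \<comment> \<open>One separating point for each pair from \<open>D\<close> suffices, which
        keeps \<open>Z\<close> within the size of \<open>K\<close>. The diagonal pairs contribute
        \<open>{}\<close> so that \<open>Z\<close> is nonempty even if \<open>D\<close> is a
        singleton.\<close>
      define Z where "Z = (\<lambda>(X, Y). if X = Y then {} else sep X Y) ` (D \<times> D)"
      have "Z \<lesssim> D \<times> D" unfolding Z_def by (rule image_lepoll)
      also have "\<dots> \<lesssim> K" using D K by (intro times_lepoll_infinite)
      finally have "Z \<lesssim> K" .
      moreover have "Z \<noteq> {}" using False by (auto simp: Z_def)
      ultimately obtain w where w: "w ` K = Z" using lepoll_imp_surj[of Z K] by blast
      have "Z \<subseteq> Pow K"
      proof
        fix z assume "z \<in> Z"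
        then obtain X Y where XY: "X \<in> D" "Y \<in> D" "z = (if X = Y then {} else sep X Y)"
          by (auto simp: Z_def)
        show "z \<in> Pow K"
        proof (cases "X = Y")
          case False
          then have "z \<in> X \<union> Y" using XY(3) sep[OF False] by auto
          with XY D(1) show ?thesis by blast
        qed (use XY in auto)
      qed
      then have wK: "w k \<subseteq> K" if "k \<in> K" for k using w that by blast
      define \<xi> where "\<xi> = enc ` ({(t0, k, l) |k l. k \<in> K \<and> l \<in> w k} \<union>
        {(t1, k, l) |k l. k \<in> K \<and> l \<in> K \<and> w l \<in> s k} \<union> {(t2, k, p (s k)) |k. k \<in> K})"
      have ps: "p (s k) \<in> K" if "k \<in> K" for k using that s D(3) by blast
      have sub: "{(t0, k, l) |k l. k \<in> K \<and> l \<in> w k} \<union>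
        {(t1, k, l) |k l. k \<in> K \<and> l \<in> K \<and> w l \<in> s k} \<union> {(t2, k, p (s k)) |k. k \<in> K} \<subseteq> K \<times> K \<times> K"
        using t wK ps by blast
      have mem: "enc (t', k, l) \<in> \<xi> \<longleftrightarrow> (t', k, l) \<in> {(t0, k, l) |k l. k \<in> K \<and> l \<in> w k} \<union>
        {(t1, k, l) |k l. k \<in> K \<and> l \<in> K \<and> w l \<in> s k} \<union> {(t2, k, p (s k)) |k. k \<in> K}"
        if "t' \<in> K" "k \<in> K" "l \<in> K" for t' k l
        unfolding \<xi>_def using that by (intro inj_on_image_mem_iff[OF enc(1) _ sub]) auto
      have dec0: "dec t0 \<xi> k = w k" if "k \<in> K" for k
        using that t wK[OF that] mem[of t0 k] by (auto simp: dec_def)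
      have dec1: "dec t1 \<xi> k = {l \<in> K. w l \<in> s k}" if "k \<in> K" for k
        using that t mem[of t1 k] by (auto simp: dec_def)
      have dec2: "dec t2 \<xi> k = {p (s k)}" if "k \<in> K" for k
        using that t ps[OF that] mem[of t2 k] by (auto simp: dec_def)
      have "ind X \<xi> = p X" if "X \<in> D" for X
      proof -
        obtain k where k: "k \<in> K" "s k = X" using \<open>X \<in> D\<close> s by auto
        have eq: "{l \<in> K. dec t0 \<xi> l \<in> X} = {l \<in> K. w l \<in> X}" using dec0 by auto
        define k' where "k' = (SOME k. k \<in> K \<and> {l \<in> K. dec t0 \<xi> l \<in> X} = dec t1 \<xi> k)"
        have k': "k' \<in> K \<and> {l \<in> K. dec t0 \<xi> l \<in> X} = dec t1 \<xi> k'"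
          unfolding k'_def by (rule someI[of _ k]) (use k eq dec1 in auto)
        \<comment> \<open>The chosen position need not be \<open>k\<close>, since \<open>s\<close>
          may repeat values. Equal traces are enough: otherwise a separator of \<open>s k'\<close>
          and \<open>X\<close> is some \<open>w l\<close>, and \<open>l\<close> would lie in exactly
          one of the two traces.\<close>
        have "s k' = X"
        proof (rule ccontr)
          assume ne: "s k' \<noteq> X"
          have "s k' \<in> D" using k' s by auto
          then have "sep (s k') X \<in> Z"
            unfolding Z_def using ne \<open>X \<in> D\<close> by (intro image_eqI[of _ _ "(s k', X)"]) auto
          then obtain l where "l \<in> K" "w l = sep (s k') X" using w by (metis imageE)
          moreover have "{l \<in> K. w l \<in> X} = {l \<in> K. w l \<in> s k'}" using k' eq dec1[of k'] by simp
          ultimately have "w l \<in> X \<longleftrightarrow> w l \<in> s k'" by blast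
          with sep[OF ne] \<open>w l = sep (s k') X\<close> show False by auto
        qed
        then show ?thesis using dec2[of k'] k' unfolding ind_def k'_def[symmetric] by simp
      qed
      moreover have "\<xi> \<in> Pow K" unfolding \<xi>_def by (rule PowI) (rule subset_trans[OF image_mono[OF sub] enc(2)])
      ultimately show ?thesis by blast
    qed auto
  qed
qed

text \<open>
  Given \<open>K\<close> many disjoint conflicts, one could prescribe for each \<open>k\<close> the value \<open>k\<close> at the
  critical function of the \<open>k\<close>-th one; at a common solution \<open>\<xi>\<close> the conflict numbered \<open>g \<xi>\<close> is
  then none. So a maximal disjoint set of conflicts has size at most \<open>K\<close>.
\<close>

lemma avoid_conflicts:
  fixes ind :: "'j \<Rightarrow> 'i \<Rightarrow> 'k"
  assumes K: "infinite K" and g: "g \<in> e \<rightarrow> K"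
    and con: "\<And>D p. D \<subseteq> J \<Longrightarrow> D \<lesssim> K \<Longrightarrow> p \<in> D \<rightarrow> K \<Longrightarrow> \<exists>\<xi>\<in>e. \<forall>d\<in>D. ind d \<xi> = p d"
  shows "\<exists>M\<subseteq>J. M \<lesssim> K \<and> (\<forall>D j p. insert j D \<subseteq> J - M \<longrightarrow> j \<notin> D \<longrightarrow> D \<lesssim> K \<longrightarrow> p \<in> D \<rightarrow> K \<longrightarrow>
           (\<exists>\<xi>\<in>e. ind j \<xi> = g \<xi> \<and> (\<forall>d\<in>D. ind d \<xi> = p d)))"
proof -
  define bad where "bad B \<longleftrightarrow> B \<subseteq> J \<and> (\<exists>D j p. B = insert j D \<and> j \<notin> D \<and> D \<lesssim> K \<and> p \<in> D \<rightarrow> K \<and>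
    \<not> (\<exists>\<xi>\<in>e. ind j \<xi> = g \<xi> \<and> (\<forall>d\<in>D. ind d \<xi> = p d)))" for B
  define \<A> where "\<A> = {T. (\<forall>B\<in>T. bad B) \<and> pairwise disjnt T}"
  have "\<exists>T\<in>\<A>. \<forall>X\<in>\<A>. T \<subseteq> X \<longrightarrow> X = T"
  proof (rule subset_Zorn')
    fix c assume c: "subset.chain \<A> c"
    have "\<Union>c \<in> \<A>"
      unfolding \<A>_def
    proof (intro CollectI conjI ballI)
      show "bad B" if "B \<in> \<Union>c" for B
        using that c by (auto simp: subset.chain_def \<A>_def)
      show "pairwise disjnt (\<Union>c)"
        unfolding pairwise_def
      proof (intro ballI impI)
        fix a b assume "a \<in> \<Union>c" "b \<in> \<Union>c" "a \<noteq> b"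
        then obtain x y where "x \<in> c" "a \<in> x" "y \<in> c" "b \<in> y" by auto
        moreover from c this have "x \<subseteq> y \<or> y \<subseteq> x" unfolding subset_chain_def by blast
        ultimately obtain z where "z \<in> c" "a \<in> z" "b \<in> z" by blast
        moreover from c \<open>z \<in> c\<close> have "pairwise disjnt z"
          unfolding subset_chain_def \<A>_def by blast
        ultimately show "disjnt a b" using \<open>a \<noteq> b\<close> by (simp add: pairwise_def)
      qed
    qed
    then show "\<Union>c \<in> \<A>" .
  qed
  then obtain T where TA: "T \<in> \<A>" and maxT: "\<forall>X\<in>\<A>. T \<subseteq> X \<longrightarrow> X = T" ..
  from TA have T: "\<forall>B\<in>T. bad B" "pairwise disjnt T" by (simp_all add: \<A>_def)
  have bad_lepoll: "B \<lesssim> K" if "bad B" for B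
  proof -
    from that obtain D j where "B = {j} \<union> D" "D \<lesssim> K" unfolding bad_def by blast
    moreover have "{j} \<lesssim> K" using K by (intro finite_lepoll_infinite) auto
    ultimately show ?thesis using K by (metis Un_lepoll_infinite)
  qed
  have "\<not> K \<lesssim> T"
  proof
    assume "K \<lesssim> T"
    then obtain h where h: "inj_on h K" "h ` K \<subseteq> T" by (auto simp: lepoll_def)
    have "\<forall>k\<in>K. \<exists>D j p. h k = insert j D \<and> j \<notin> D \<and> D \<lesssim> K \<and> p \<in> D \<rightarrow> K \<and>
      \<not> (\<exists>\<xi>\<in>e. ind j \<xi> = g \<xi> \<and> (\<forall>d\<in>D. ind d \<xi> = p d))"
      using h(2) T(1) unfolding bad_def by blast
    then obtain D j p where *: "\<And>k. k \<in> K \<Longrightarrow> h k = insert (j k) (D k) \<and> j k \<notin> D k \<and> D k \<lesssim> K \<and> p k \<in> D k \<rightarrow> K \<and>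
      \<not> (\<exists>\<xi>\<in>e. ind (j k) \<xi> = g \<xi> \<and> (\<forall>d\<in>D k. ind d \<xi> = p k d))"
      by metis
    have uniq: "k = k'" if "k \<in> K" "k' \<in> K" "x \<in> h k" "x \<in> h k'" for k k' x
    proof (rule ccontr)
      assume "k \<noteq> k'"
      with that h have "h k \<noteq> h k'" by (auto simp: inj_on_def)
      with T(2) that h(2) have "disjnt (h k) (h k')" by (auto simp: pairwise_def)
      with that show False by (auto simp: disjnt_def)
    qed
    \<comment> \<open>Disjointness of the conflicts makes the combined prescription unambiguous:
      each \<open>x\<close> lies in at most one \<open>h k\<close>. Since
      \<open>j k \<notin> D k\<close>, the value \<open>k\<close> at \<open>j k\<close> does not
      disturb \<open>p k\<close> on \<open>D k\<close>.\<close>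
    define P where "P x = (let k = (SOME k. k \<in> K \<and> x \<in> h k) in if x = j k then k else p k x)" for x
    have P: "P x = (if x = j k then k else p k x)" if "k \<in> K" "x \<in> h k" for k x
    proof -
      have "(SOME k. k \<in> K \<and> x \<in> h k) = k" using that uniq by (intro some_equality) auto
      then show ?thesis by (simp add: P_def)
    qed
    have "\<exists>\<xi>\<in>e. \<forall>d\<in>(\<Union>k\<in>K. h k). ind d \<xi> = P d"
    proof (rule con)
      show "(\<Union>k\<in>K. h k) \<subseteq> J" using h T(1) unfolding bad_def by blast
      show "(\<Union>k\<in>K. h k) \<lesssim> K" using h T(1) K bad_lepoll by (intro UN_lepoll_infinite) auto
      show "P \<in> (\<Union>k\<in>K. h k) \<rightarrow> K"
      proof
        fix x assume "x \<in> (\<Union>k\<in>K. h k)"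
        then obtain k where k: "k \<in> K" "x \<in> h k" by auto
        then show "P x \<in> K" using P[OF k] *[OF k(1)] by auto
      qed
    qed
    then obtain \<xi> where \<xi>: "\<xi> \<in> e" "\<And>k d. k \<in> K \<Longrightarrow> d \<in> h k \<Longrightarrow> ind d \<xi> = P d" by blast
    define k where "k = g \<xi>"
    have k: "k \<in> K" using \<xi>(1) g by (auto simp: k_def)
    have "ind (j k) \<xi> = g \<xi>" using \<xi>(2)[OF k] P[OF k] *[OF k] by (simp add: k_def)
    moreover have "ind d \<xi> = p k d" if "d \<in> D k" for d
      using that \<xi>(2)[OF k, of d] P[OF k, of d] *[OF k] by auto
    ultimately show False using *[OF k] \<xi>(1) by blast
  qed
  then have TK: "T \<lesssim> K" by (rule not_lepoll_imp_lepoll)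
  define M where "M = \<Union>T"
  have M: "M \<subseteq> J" using T(1) unfolding M_def bad_def by blast
  have MK: "M \<lesssim> K"
    using UN_lepoll_infinite[OF K TK, of "\<lambda>x. x"] T(1) bad_lepoll by (simp add: M_def)
  have avoid: "\<exists>\<xi>\<in>e. ind j \<xi> = g \<xi> \<and> (\<forall>d\<in>D. ind d \<xi> = p d)"
    if "insert j D \<subseteq> J - M" "j \<notin> D" "D \<lesssim> K" "p \<in> D \<rightarrow> K" for D j p
  proof (rule ccontr)
    assume "\<not> ?thesis"
    with that have B: "bad (insert j D)" unfolding bad_def by blast
    \<comment> \<open>A conflict disjoint from \<open>M\<close> can be added to \<open>T\<close>.
      Maximality then puts it into \<open>T\<close> already, so \<open>j\<close> would belong to
      \<open>M\<close>.\<close>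
    have "insert (insert j D) T \<in> \<A>"
      using T B that(1) by (auto simp: \<A>_def M_def pairwise_def disjnt_def)
    then have "insert (insert j D) T = T" using maxT by blast
    then have "insert j D \<subseteq> M" by (auto simp: M_def)
    with that show False by blast
  qed
  show ?thesis
    by (rule exI[of _ M]) (intro conjI allI impI M MK avoid)
qed

section \<open>Transfinite choice of partners\<close>

lemma lesspoll_iff_card_of: "A \<prec> B \<longleftrightarrow> ordLess2 (card_of A) (card_of B)"
  by (metis eqpoll_iff_card_of_ordIso lepoll_iff_card_of lesspoll_def
      not_ordLess_ordIso ordLess_imp_ordLeq ordLeq_iff_ordLess_or_ordIso)

text \<open>\<open>card_of A\<close> is a well-order of least possible length, so its proper initial
  segments are strictly smaller than \<open>A\<close>. Along it, no stage has exhausted the supply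
  of functions.\<close>

lemma underS_lesspoll: "c \<in> A \<Longrightarrow> underS (card_of A) c \<prec> A"
  using card_of_underS[OF card_of_Card_order[of A], of c]
  by (simp add: lesspoll_iff_card_of Field_card_of)

lemma Plus_lesspoll_infinite:
  assumes "infinite C" "A \<prec> C" "B \<prec> C"
  shows "A <+> B \<prec> C"
  using assms card_of_Plus_ordLess_infinite[of C A B] by (simp add: lesspoll_iff_card_of)

text \<open>Reduces the consistency of a finite set of tasks to the invariant recorded at its last
  task, for which all the others are earlier.\<close>

lemma finite_has_last:
  assumes "finite W" "W \<noteq> {}" "W \<subseteq> A"
  shows "\<exists>z\<in>W. W \<subseteq> insert z (underS (card_of A) z)"
  using assms
proof (induction rule: finite_ne_induct)
  case (insert x W)
  have lin: "linear_order_on A (card_of A)"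
    using card_of_well_order_on[of A] by (simp add: well_order_on_def)
  from insert obtain z where z: "z \<in> W" "W \<subseteq> insert z (underS (card_of A) z)" by auto
  then have zA: "z \<in> A" "x \<in> A" "x \<noteq> z" using insert by auto
  have tr: "trans (card_of A)" and an: "antisym (card_of A)"
    using lin by (auto simp: order_on_defs)
  from lin zA consider "(x, z) \<in> card_of A" | "(z, x) \<in> card_of A"
    by (auto simp: order_on_defs total_on_def)
  then show ?case
  proof cases
    case 1
    with z zA show ?thesis by (intro bexI[of _ z]) (auto simp: underS_def)
  next
    case 2
    have "w \<in> underS (card_of A) x" if "w \<in> W" for w
    proof (cases "w = z")
      case False
      with z that have "(w, z) \<in> card_of A" by (auto simp: underS_def)
      with 2 tr have "(w, x) \<in> card_of A" by (auto elim: transE)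
      moreover have "w \<noteq> x" using insert that by auto
      ultimately show ?thesis by (simp add: underS_def)
    qed (use 2 zA in \<open>auto simp: underS_def\<close>)
    then show ?thesis by auto
  qed
qed simp

lemma underS_card_of_trans:
  assumes "z \<in> underS (card_of A) c" "w \<in> underS (card_of A) z"
  shows "w \<in> underS (card_of A) c"
proof -
  have "linear_order_on A (card_of A)"
    using card_of_well_order_on[of A] by (simp add: well_order_on_def)
  then have "trans (card_of A)" "antisym (card_of A)" by (auto simp: order_on_defs)
  with assms show ?thesis by (auto simp: underS_def elim: transE antisymD dest: antisymD)
qed

text \<open>
  \<open>Ag t \<xi> \<rho>\<close> stands for a winning position \<open>\<rho>\<close> in the game of kind \<open>t\<close> at the index \<open>\<xi>\<close>, \<open>nx t\<close>
  for the game that is one move longer; a task \<open>c\<close> asks for a partner of an element of either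
  product, and \<open>pr c v \<xi>\<close> is the resulting pair at \<open>\<xi>\<close> when the partner has number \<open>v\<close> there.
\<close>

theorem back_and_forth_choice:
  fixes K :: "'k set" and J :: "'j set" and I :: "'i set" and ind :: "'j \<Rightarrow> 'i \<Rightarrow> 'k"
    and T :: "'t set" and Ag :: "'t \<Rightarrow> 'i \<Rightarrow> 'q set \<Rightarrow> bool"
    and Task :: "'c set" and pr :: "'c \<Rightarrow> 'k \<Rightarrow> 'i \<Rightarrow> 'q"
  assumes K: "infinite K" and TK: "T \<lesssim> K" and KJ: "K \<prec> J" and Task: "Task \<lesssim> J"
    and nx: "\<And>t. t \<in> T \<Longrightarrow> nx t \<in> T"
    and start: "\<And>t D p. t \<in> T \<Longrightarrow> D \<subseteq> J \<Longrightarrow> D \<lesssim> K \<Longrightarrow> p \<in> D \<rightarrow> K \<Longrightarrow>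
      \<exists>\<xi>\<in>I. Ag t \<xi> {} \<and> (\<forall>d\<in>D. ind d \<xi> = p d)"
    and ext: "\<And>t \<xi> c \<rho>. t \<in> T \<Longrightarrow> \<xi> \<in> I \<Longrightarrow> c \<in> Task \<Longrightarrow> Ag (nx t) \<xi> \<rho> \<Longrightarrow>
      \<exists>v\<in>K. Ag t \<xi> (insert (pr c v \<xi>) \<rho>)"
    and mono: "\<And>t \<xi> \<rho> \<rho>'. Ag t \<xi> \<rho> \<Longrightarrow> \<rho>' \<subseteq> \<rho> \<Longrightarrow> Ag t \<xi> \<rho>'"
  shows "\<exists>j. \<forall>t\<in>T. \<forall>W. finite W \<longrightarrow> W \<subseteq> Task \<longrightarrow>
    (\<exists>\<xi>\<in>I. Ag t \<xi> ((\<lambda>c. pr c (ind (j c) \<xi>) \<xi>) ` W))"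
proof -
  define U where "U = underS (card_of Task)"
  define q where "q f W \<xi> = (\<lambda>c. pr c (ind (fst (f c)) \<xi>) \<xi>) ` W"
    for f :: "'c \<Rightarrow> 'j \<times> 'j set" and W \<xi>
  define N where "N f c = (\<Union>z\<in>U c. snd (f z))" for f :: "'c \<Rightarrow> 'j \<times> 'j set" and c
  txt \<open>\<open>snd x\<close> collects the functions that become unavailable at stage \<open>c\<close>.\<close>
  define P where "P f c x \<longleftrightarrow> (c \<in> Task \<longrightarrow> fst x \<in> J \<and> snd x \<subseteq> J \<and> snd x \<lesssim> K <+> U c \<and>
    (\<forall>t\<in>T. \<forall>W. finite W \<longrightarrow> W \<subseteq> U c \<longrightarrow> (\<forall>D p. D \<subseteq> J - N f c - snd x \<longrightarrow> D \<lesssim> K \<longrightarrow> p \<in> D \<rightarrow> K \<longrightarrow>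
      (\<exists>\<xi>\<in>I. Ag t \<xi> (insert (pr c (ind (fst x) \<xi>) \<xi>) (q f W \<xi>)) \<and> (\<forall>d\<in>D. ind d \<xi> = p d)))))"
    for f c x
  have UTask: "U c \<subseteq> Task" for c
    using Field_card_of[of Task] by (auto simp: U_def underS_def Field_def)
  \<comment> \<open>For nonempty \<open>W\<close> the invariant at the last task of \<open>W\<close>
    already covers the remaining ones; for empty \<open>W\<close> this is the hypothesis
    \<open>start\<close>. \<open>V\<close> is an initial segment, so avoiding the functions spoiled
    in \<open>V\<close> includes avoiding those spoiled before that last task.\<close>
  have consistent: "\<exists>\<xi>\<in>I. Ag t \<xi> (q f W \<xi>) \<and> (\<forall>d\<in>D. ind d \<xi> = p d)"
    if f: "\<And>z. z \<in> V \<Longrightarrow> P f z (f z)" and t: "t \<in> T" and W: "finite W" "W \<subseteq> V" and VT: "V \<subseteq> Task"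
      and V: "\<And>z. z \<in> V \<Longrightarrow> U z \<subseteq> V"
      and D: "D \<subseteq> J - (\<Union>z\<in>V. snd (f z))" "D \<lesssim> K" "p \<in> D \<rightarrow> K" for f V t W D p
  proof (cases "W = {}")
    case True
    have "D \<subseteq> J" using D(1) by blast
    from start[OF t this D(2,3)] show ?thesis by (simp add: True q_def)
  next
    case False
    have "W \<subseteq> Task" using W VT by blast
    from finite_has_last[OF W(1) False this] obtain z where z: "z \<in> W" "W \<subseteq> insert z (U z)"
      by (auto simp: U_def)
    have zV: "z \<in> V" using z W by blast
    then have zT: "z \<in> Task" using VT by blast
    have "D \<subseteq> J - N f z - snd (f z)" using D(1) zV V[OF zV] unfolding N_def by blast
    moreover have "finite (W - {z})" "W - {z} \<subseteq> U z" using z W by auto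
    ultimately have "\<exists>\<xi>\<in>I. Ag t \<xi> (insert (pr z (ind (fst (f z)) \<xi>) \<xi>) (q f (W - {z}) \<xi>)) \<and> (\<forall>d\<in>D. ind d \<xi> = p d)"
      using f[OF zV] zT t D(2,3) unfolding P_def by blast
    moreover have "q f W \<xi> = insert (pr z (ind (fst (f z)) \<xi>) \<xi>) (q f (W - {z}) \<xi>)" for \<xi>
      using z(1) by (auto simp: q_def)
    ultimately show ?thesis by simp
  qed
  have J: "infinite J" using K KJ by (meson eqpoll_finite_iff infinite_le_lepoll lepoll_trans lesspoll_imp_lepoll)
  have "\<exists>f. \<forall>c. P f c (f c)"
  proof (rule dependent_wf_choice)
    show "wf (card_of Task - Id)"
      using card_of_well_order_on[of Task] by (simp add: well_order_on_def)
  next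
    fix f g :: "'c \<Rightarrow> 'j \<times> 'j set" and c x
    assume "\<And>z. (z, c) \<in> card_of Task - Id \<Longrightarrow> f z = g z"
    then have eq: "f z = g z" if "z \<in> U c" for z using that by (auto simp: U_def underS_def)
    then have "N f c = N g c" "\<And>W \<xi>. W \<subseteq> U c \<Longrightarrow> q f W \<xi> = q g W \<xi>"
      by (auto simp: N_def q_def intro!: image_cong)
    then show "P f c x = P g c x" unfolding P_def by (simp cong: conj_cong)
  next
    fix c f
    assume "\<And>z. (z, c) \<in> card_of Task - Id \<Longrightarrow> P f z (f z)"
    then have IH: "P f z (f z)" if "z \<in> U c" for z using that by (auto simp: U_def underS_def)
    show "\<exists>x. P f c x"
    proof (cases "c \<in> Task")
      case c: True
      have inf: "infinite (K <+> U c)" using K by auto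
      have UK: "U c \<lesssim> K <+> U c" and KK: "K \<lesssim> K <+> U c"
        by (auto simp: lepoll_def intro: exI[of _ Inl] exI[of _ Inr])
      have UU: "U z \<subseteq> U c" if "z \<in> U c" for z
        using that underS_card_of_trans unfolding U_def by fast
      have con: "\<exists>\<xi>\<in>I. Ag t \<xi> (q f W \<xi>) \<and> (\<forall>d\<in>D. ind d \<xi> = p d)"
        if "t \<in> T" "finite W" "W \<subseteq> U c" "D \<subseteq> J - N f c" "D \<lesssim> K" "p \<in> D \<rightarrow> K" for t W D p
        using that IH UTask UU unfolding N_def by (intro consistent[of "U c"]) auto
      define good where "good t W M \<longleftrightarrow> M \<subseteq> J - N f c \<and> M \<lesssim> K \<and>
        (\<forall>D j p. insert j D \<subseteq> J - N f c - M \<longrightarrow> j \<notin> D \<longrightarrow> D \<lesssim> K \<longrightarrow> p \<in> D \<rightarrow> K \<longrightarrow>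
           (\<exists>\<xi>\<in>I. Ag t \<xi> (insert (pr c (ind j \<xi>) \<xi>) (q f W \<xi>)) \<and> (\<forall>d\<in>D. ind d \<xi> = p d)))" for t W M
      have "\<forall>tW\<in>T \<times> Fpow (U c). \<exists>M. good (fst tW) (snd tW) M"
      proof
        fix tW assume tW: "tW \<in> T \<times> Fpow (U c)"
        obtain t W where [simp]: "tW = (t, W)" by force
        have t: "t \<in> T" "finite W" "W \<subseteq> U c" using tW by (auto simp: Fpow_def)
        \<comment> \<open>At the indices in \<open>e\<close> the old position wins the longer game
          \<open>nx t\<close>, so some answer wins \<open>t\<close>; \<open>g\<close> picks it. It
          remains to find a \<open>j\<close> that agrees with \<open>g\<close> somewhere in
          \<open>e\<close> under every admissible prescription, and \<open>avoid_conflicts\<close>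
          leaves at most \<open>K\<close> exceptions.\<close>
        define e where "e = {\<xi>\<in>I. Ag (nx t) \<xi> (q f W \<xi>)}"
        define g where "g \<xi> = (SOME v. v \<in> K \<and> Ag t \<xi> (insert (pr c v \<xi>) (q f W \<xi>)))" for \<xi>
        have g: "g \<xi> \<in> K \<and> Ag t \<xi> (insert (pr c (g \<xi>) \<xi>) (q f W \<xi>))" if "\<xi> \<in> e" for \<xi>
        proof -
          have "\<exists>v. v \<in> K \<and> Ag t \<xi> (insert (pr c v \<xi>) (q f W \<xi>))"
            using that t ext[OF t(1) _ c] unfolding e_def by blast
          then show ?thesis unfolding g_def by (rule someI_ex)
        qed
        have cone: "\<exists>\<xi>\<in>e. \<forall>d\<in>D. ind d \<xi> = p d" if "D \<subseteq> J - N f c" "D \<lesssim> K" "p \<in> D \<rightarrow> K" for D p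
          using con[OF nx[OF t(1)] t(2,3) that] unfolding e_def by blast
        have ge: "g \<in> e \<rightarrow> K" using g by blast
        have "\<exists>M\<subseteq>J - N f c. M \<lesssim> K \<and>
          (\<forall>D j p. insert j D \<subseteq> J - N f c - M \<longrightarrow> j \<notin> D \<longrightarrow> D \<lesssim> K \<longrightarrow> p \<in> D \<rightarrow> K \<longrightarrow>
           (\<exists>\<xi>\<in>e. ind j \<xi> = g \<xi> \<and> (\<forall>d\<in>D. ind d \<xi> = p d)))"
          by (rule avoid_conflicts[OF K ge]) (rule cone)
        then obtain M where M: "M \<subseteq> J - N f c \<and> M \<lesssim> K \<and>
          (\<forall>D j p. insert j D \<subseteq> J - N f c - M \<longrightarrow> j \<notin> D \<longrightarrow> D \<lesssim> K \<longrightarrow> p \<in> D \<rightarrow> K \<longrightarrow>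
           (\<exists>\<xi>\<in>e. ind j \<xi> = g \<xi> \<and> (\<forall>d\<in>D. ind d \<xi> = p d)))" ..
        have "\<exists>\<xi>\<in>I. Ag t \<xi> (insert (pr c (ind j \<xi>) \<xi>) (q f W \<xi>)) \<and> (\<forall>d\<in>D. ind d \<xi> = p d)"
          if "insert j D \<subseteq> J - N f c - M" "j \<notin> D" "D \<lesssim> K" "p \<in> D \<rightarrow> K" for D j p
        proof -
          from M that obtain \<xi> where \<xi>: "\<xi> \<in> e" "ind j \<xi> = g \<xi>" "\<forall>d\<in>D. ind d \<xi> = p d" by blast
          from g[OF \<xi>(1)] \<xi> show ?thesis unfolding e_def by (intro bexI[of _ \<xi>]) auto
        qed
        with M have "good t W M" unfolding good_def by simp
        then show "\<exists>M. good (fst tW) (snd tW) M" by (intro exI[of _ M]) simp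
      qed
      then obtain M where "\<forall>tW\<in>T \<times> Fpow (U c). good (fst tW) (snd tW) (M tW)"
        by (rule bchoice[elim_format]) (erule exE)
      then have Mg: "good t W (M (t, W))" if "t \<in> T" "finite W" "W \<subseteq> U c" for t W
        using that by (auto simp: Fpow_def)
      then have M: "M (t, W) \<subseteq> J - N f c" "M (t, W) \<lesssim> K" if "t \<in> T" "finite W" "W \<subseteq> U c" for t W
        using Mg[OF that] unfolding good_def by simp_all
      \<comment> \<open>One function has to serve all kinds \<open>t\<close> and all finite
        \<open>W\<close> at once, so all the exceptional sets are discarded together.\<close>
      define M' where "M' = (\<Union>tW\<in>T \<times> Fpow (U c). M tW)"
      have FpU: "Fpow (U c) \<lesssim> K <+> U c"
      proof -
        have "inj_on (image Inr) (Fpow (U c))"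
          by (rule inj_on_image_Fpow) simp
        moreover have "image Inr ` Fpow (U c) \<subseteq> Fpow (K <+> U c)" by (auto simp: Fpow_def)
        ultimately have "Fpow (U c) \<lesssim> Fpow (K <+> U c)"
          unfolding lepoll_def by (intro exI conjI)
        also have "\<dots> \<lesssim> K <+> U c" by (rule Fpow_lepoll_infinite[OF inf])
        finally show ?thesis .
      qed
      have M'le: "M' \<lesssim> K <+> U c"
        unfolding M'_def
      proof (rule UN_lepoll_infinite[OF inf])
        show "T \<times> Fpow (U c) \<lesssim> K <+> U c"
          by (rule times_lepoll_infinite[OF inf lepoll_trans[OF TK KK] FpU])
        show "M tW \<lesssim> K <+> U c" if "tW \<in> T \<times> Fpow (U c)" for tW
        proof -
          obtain t W where tW: "tW = (t, W)" by force
          with that have "M tW \<lesssim> K" using M(2)[of t W] by (auto simp: Fpow_def)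
          then show ?thesis using KK by (rule lepoll_trans)
        qed
      qed
      have Nle: "N f c \<lesssim> K <+> U c"
        unfolding N_def
      proof (rule UN_lepoll_infinite[OF inf UK])
        fix z assume z: "z \<in> U c"
        then have "snd (f z) \<lesssim> K <+> U z" using IH[OF z] UTask unfolding P_def by blast
        also have "\<dots> \<lesssim> K <+> U c" using UU[OF z] by (intro sum_lepoll_mono) (auto intro: subset_imp_lepoll)
        finally show "snd (f z) \<lesssim> K <+> U c" .
      qed
      have less: "K <+> U c \<prec> J"
        using underS_lesspoll[OF c] lesspoll_trans2[OF _ Task] KJ J
        unfolding U_def by (intro Plus_lesspoll_infinite) auto
      \<comment> \<open>The functions spoiled earlier and those in \<open>M'\<close> number at most
        \<open>K <+> U c\<close>, which is below \<open>J\<close> because \<open>U c\<close> is a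
        proper initial segment. So an unspoiled function remains.\<close>
      have "\<not> J \<subseteq> N f c \<union> M'"
      proof
        assume "J \<subseteq> N f c \<union> M'"
        then have "J \<lesssim> N f c \<union> M'" by (rule subset_imp_lepoll)
        also have "\<dots> \<lesssim> K <+> U c" using inf Nle M'le by (rule Un_lepoll_infinite)
        also have "\<dots> \<prec> J" by (rule less)
        finally show False by simp
      qed
      then obtain j where j: "j \<in> J" "j \<notin> N f c" "j \<notin> M'" by blast
      \<comment> \<open>Besides the exceptions, \<open>j\<close> itself is spoiled: its value now
        encodes the partner of \<open>c\<close> and can no longer be prescribed.\<close>
      have "P f c (j, insert j M')"
        unfolding P_def fst_conv snd_conv
      proof (intro impI conjI ballI allI)
        show "insert j M' \<subseteq> J" using j(1) M by (auto simp: M'_def Fpow_def)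
        show "insert j M' \<lesssim> K <+> U c"
          using Un_lepoll_infinite[OF inf _ M'le, of "{j}"] inf by (simp add: finite_lepoll_infinite)
        fix t W D p assume *: "t \<in> T" "finite W" "W \<subseteq> U c" "D \<subseteq> J - N f c - insert j M'" "D \<lesssim> K" "p \<in> D \<rightarrow> K"
        have sub: "M (t, W) \<subseteq> M'" using * by (auto simp: M'_def Fpow_def)
        then have "insert j D \<subseteq> J - N f c - M (t, W)" "j \<notin> D" using * j by auto
        then show "\<exists>\<xi>\<in>I. Ag t \<xi> (insert (pr c (ind j \<xi>) \<xi>) (q f W \<xi>)) \<and> (\<forall>d\<in>D. ind d \<xi> = p d)"
          using Mg[OF *(1-3)] *(5,6) unfolding good_def by blast
      qed (use j in auto)
      then show ?thesis by blast
    qed (auto simp: P_def)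
  qed
  then obtain f where f: "\<And>c. P f c (f c)" by blast
  show ?thesis
  proof (intro exI[of _ "\<lambda>c. fst (f c)"] ballI allI impI)
    fix t W assume "t \<in> T" "finite W" "W \<subseteq> Task"
    \<comment> \<open>No value is prescribed any more; \<open>undefined\<close> merely stands for
      some function on the empty set.\<close>
    then have "\<exists>\<xi>\<in>I. Ag t \<xi> (q f W \<xi>) \<and> (\<forall>d\<in>{}. ind d \<xi> = undefined d)"
      using f UTask by (intro consistent[of Task]) auto
    then show "\<exists>\<xi>\<in>I. Ag t \<xi> ((\<lambda>c. pr c (ind (fst (f c)) \<xi>) \<xi>) ` W)" by (simp add: q_def)
  qed
qed

section \<open>Products and varieties\<close>

text \<open>These are the HOL sets on which \<open>vset\<close> is inverse to \<open>elts\<close>;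
  each carrier built with \<open>vset\<close> has to be shown small before its elements are
  known.\<close>

definition small :: "'v::zf_universe set \<Rightarrow> bool" where
  "small A \<longleftrightarrow> A \<in> range elts"

lemma elts_vset_small [simp]: "small A \<Longrightarrow> elts (vset A) = A"
  by (simp add: small_def elts_vset)

lemma small_elts [simp]: "small (elts x)"
  by (simp add: small_def)

lemma small_subset: "small B \<Longrightarrow> A \<subseteq> B \<Longrightarrow> small A"
  by (auto simp: small_def intro: separation)

lemma small_image [simp]: "small A \<Longrightarrow> small (f ` A)" for f :: "'v::zf_universe \<Rightarrow> 'v"
  unfolding small_def by (elim imageE) (simp only: replacement)

lemma small_UN:
  fixes A :: "'v::zf_universe set" and B :: "'v \<Rightarrow> 'v set"
  assumes "small A" "\<And>a. a \<in> A \<Longrightarrow> small (B a)"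
  shows "small (\<Union>a\<in>A. B a)"
proof -
  let ?x = "vset ((\<lambda>a. vset (B a)) ` A)"
  have "\<Union> (elts ` elts ?x) = (\<Union>a\<in>A. B a)" using assms by simp
  then show ?thesis using union[of ?x] by (simp add: small_def)
qed

lemma small_Pow: "small A \<Longrightarrow> small {y. elts y \<subseteq> A}"
  using power by (auto simp: small_def)

text \<open>A dominated set is contained in an image of the dominating one, so replacement and
  separation apply. Cardinality bounds thereby become membership in the universe.\<close>

lemma small_lepoll:
  fixes A B :: "'v::zf_universe set"
  assumes "A \<lesssim> B" "small B"
  shows "small A"
  using assms by (metis lepoll_iff small_image small_subset)

text \<open>Pairing is obtained from infinity: two points are dominated by an infinite set of the
  universe.\<close>

lemma small_doubleton [simp]: "small {a, b}"
proof -
  obtain x :: 'a where "infinite (elts x)" using infinity by blast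
  then have "{a, b} \<lesssim> elts x" by (intro finite_lepoll_infinite) auto
  then show ?thesis by (rule small_lepoll) simp
qed

lemma small_singleton [simp]: "small {a}"
  using small_doubleton[of a a] by simp

lemma small_Un: "small A \<Longrightarrow> small B \<Longrightarrow> small (A \<union> B)"
proof -
  assume "small A" "small B"
  then have "small (\<Union>x\<in>{vset A, vset B}. elts x)" by (intro small_UN) auto
  with \<open>small A\<close> \<open>small B\<close> show ?thesis by simp
qed

lemma vpair_eq_iff [simp]: "vpair a b = vpair c d \<longleftrightarrow> a = c \<and> b = d"
proof
  assume eq: "vpair a b = vpair c d"
  have inj: "vset A = vset B \<longleftrightarrow> A = B" if "small A" "small B" for A B :: "'a set"
    using that elts_vset_small by metis
  have "{vset {a}, vset {a, b}} = {vset {c}, vset {c, d}}"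
    using eq by (simp add: vpair_def inj)
  then show "a = c \<and> b = d" by (auto simp: doubleton_eq_iff inj)
qed simp

lemma elts_vfun: "elts (vfun I f) = (\<lambda>i. vpair i (f i)) ` elts I"
  by (simp add: vfun_def)

lemma vapp_vfun [simp]: "i \<in> elts I \<Longrightarrow> vapp (vfun I f) i = f i"
  by (auto simp: vapp_def elts_vfun image_iff)

lemma vfun_cong: "(\<And>i. i \<in> elts I \<Longrightarrow> f i = g i) \<Longrightarrow> vfun I f = vfun I g"
  by (rule extensionality) (auto simp: elts_vfun)

text \<open>The content is smallness: all graphs of choice functions are subsets of the union
  \<open>?Z\<close>, so they form part of a power set.\<close>

lemma elts_carr_product:
  "elts (carr (product L I P)) = vfun I ` (\<Pi>\<^sub>E i\<in>elts I. elts (carr (P i)))"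
proof -
  let ?Z = "\<Union>i\<in>elts I. vpair i ` elts (carr (P i))"
  have "small {y. elts y \<subseteq> ?Z}" by (intro small_Pow small_UN) auto
  then have "small (vfun I ` (\<Pi>\<^sub>E i\<in>elts I. elts (carr (P i))))"
    by (rule small_subset) (fastforce simp: elts_vfun dest: PiE_mem)
  then show ?thesis by (simp add: product_def Let_def)
qed

lemma vfun_in_product [simp]:
  "vfun I f \<in> elts (carr (product L I P)) \<longleftrightarrow> (\<forall>i\<in>elts I. f i \<in> elts (carr (P i)))"
proof
  assume "vfun I f \<in> elts (carr (product L I P))"
  then obtain g where g: "vfun I f = vfun I g" "g \<in> (\<Pi>\<^sub>E i\<in>elts I. elts (carr (P i)))"
    by (auto simp: elts_carr_product)
  have "f i = g i" if "i \<in> elts I" for i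
    using arg_cong[OF g(1), of "\<lambda>z. vapp z i"] that by simp
  with g(2) show "\<forall>i\<in>elts I. f i \<in> elts (carr (P i))" by auto
next
  assume "\<forall>i\<in>elts I. f i \<in> elts (carr (P i))"
  then show "vfun I f \<in> elts (carr (product L I P))"
    unfolding elts_carr_product
    by (intro image_eqI[of _ _ "restrict f (elts I)"]) (auto intro: vfun_cong)
qed

lemma vfun_vapp: "z \<in> elts (carr (product L I P)) \<Longrightarrow> vfun I (vapp z) = z"
  unfolding elts_carr_product by (elim imageE) (simp, rule vfun_cong, simp)

lemma vapp_in_product:
  assumes "z \<in> elts (carr (product L I P))" "i \<in> elts I"
  shows "vapp z i \<in> elts (carr (P i))"
  using assms by (auto simp: elts_carr_product dest: PiE_mem)

lemma product_eqI:
  assumes "z \<in> elts (carr (product L I P))" "w \<in> elts (carr (product L I Q))"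
    "\<And>i. i \<in> elts I \<Longrightarrow> vapp z i = vapp w i"
  shows "z = w"
proof -
  have "vfun I (vapp z) = vfun I (vapp w)" by (rule vfun_cong) (rule assms(3))
  then show ?thesis by (simp only: vfun_vapp[OF assms(1)] vfun_vapp[OF assms(2)])
qed

lemma fn_product:
  assumes "f \<in> elts (fsyms L)" "xs \<in> tuples (carr (product L I P)) (farity L f)"
  shows "fn (product L I P) f xs = vfun I (\<lambda>i. fn (P i) f (map (\<lambda>x. vapp x i) xs))"
  using assms by (simp add: product_def Let_def)

lemma is_structure_fn:
  assumes "is_structure L P" "f \<in> elts (fsyms L)" "xs \<in> tuples (carr P) (farity L f)"
  shows "fn P f xs \<in> elts (carr P)"
  using assms unfolding is_structure_def by metis

lemma is_structure_nonempty: "is_structure L P \<Longrightarrow> elts (carr P) \<noteq> {}"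
  by (simp add: is_structure_def)

lemma tuples_product_vapp:
  assumes "xs \<in> tuples (carr (product L I P)) n" "i \<in> elts I"
  shows "map (\<lambda>x. vapp x i) xs \<in> tuples (carr (P i)) n"
  using assms vapp_in_product[of _ L I P i] by (auto simp: tuples_def)

lemma fn_product_closed:
  assumes "\<And>i. i \<in> elts I \<Longrightarrow> is_structure L (P i)"
    "f \<in> elts (fsyms L)" "xs \<in> tuples (carr (product L I P)) (farity L f)"
  shows "fn (product L I P) f xs \<in> elts (carr (product L I P))"
  unfolding fn_product[OF assms(2,3)] vfun_in_product
  using is_structure_fn[OF assms(1) assms(2)] tuples_product_vapp[OF assms(3)] by blast

lemma is_structure_product:
  assumes "\<And>i. i \<in> elts I \<Longrightarrow> is_structure L (P i)"
  shows "is_structure L (product L I P)"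
proof -
  have "(\<Pi>\<^sub>E i\<in>elts I. elts (carr (P i))) \<noteq> {}"
    using is_structure_nonempty[OF assms] by (auto simp: PiE_eq_empty_iff)
  then have "elts (carr (product L I P)) \<noteq> {}" by (simp add: elts_carr_product)
  moreover have "fn (product L I P) f xs = undefined"
    if "\<not> (f \<in> elts (fsyms L) \<and> xs \<in> tuples (carr (product L I P)) (farity L f))" for f xs
    using that by (auto simp: product_def Let_def)
  moreover have "if r \<in> elts (rsyms L) then rl (product L I P) r \<subseteq> tuples (carr (product L I P)) (rarity L r)
          else rl (product L I P) r = {}" for r
    by (auto simp: product_def Let_def)
  ultimately show ?thesis
    using fn_product_closed[OF assms] unfolding is_structure_def by simp
qed

section \<open>Homomorphisms and generated varieties\<close>

lemma homD:
  assumes "h \<in> hom L A B"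
  shows "x \<in> elts (carr A) \<Longrightarrow> h x \<in> elts (carr B)"
    and "f \<in> elts (fsyms L) \<Longrightarrow> xs \<in> tuples (carr A) (farity L f) \<Longrightarrow> h (fn A f xs) = fn B f (map h xs)"
    and "r \<in> elts (rsyms L) \<Longrightarrow> xs \<in> rl A r \<Longrightarrow> map h xs \<in> rl B r"
  using assms by (auto simp: hom_def)

lemma HSP_mono: "K \<subseteq> K' \<Longrightarrow> HSP F K \<subseteq> HSP F K'"
  unfolding HSP_def opH_def opS_def opP_def by blast

text \<open>Embeddings of the factors combine into an injection \<open>m\<close> of the direct
  products. A subalgebra \<open>Y\<close> of the first product is carried to an isomorphic
  subalgebra \<open>Y'\<close> of the second, and every homomorphic image of \<open>Y\<close> is one
  of \<open>Y'\<close>.\<close>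

lemma HSP_subset_if_embeds:
  assumes F: "algebraic F" and K: "K \<subseteq> Collect (is_structure F)"
    and emb: "\<And>A. A \<in> K' \<Longrightarrow> \<exists>B\<in>K. inj_hom F A B"
  shows "HSP F K' \<subseteq> HSP F K"
proof
  fix X assume "X \<in> HSP F K'"
  then obtain Y I A where X: "is_structure F X" "surj_hom F Y X" and Y: "is_structure F Y"
    "subalgebra F Y (product F I A)" and A: "\<forall>i\<in>elts I. A i \<in> K'"
    unfolding HSP_def opH_def opS_def opP_def by blast
  obtain h where h: "h \<in> hom F Y X" "h ` elts (carr Y) = elts (carr X)"
    using X(2) by (auto simp: surj_hom_def)
  have "\<forall>i\<in>elts I. \<exists>B e. B \<in> K \<and> e \<in> hom F (A i) B \<and> inj_on e (elts (carr (A i)))"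
    using A emb unfolding inj_hom_def by metis
  then obtain B e where B: "\<And>i. i \<in> elts I \<Longrightarrow> B i \<in> K"
    and e: "\<And>i. i \<in> elts I \<Longrightarrow> e i \<in> hom F (A i) (B i)"
      "\<And>i. i \<in> elts I \<Longrightarrow> inj_on (e i) (elts (carr (A i)))"
    by metis
  have Bs: "is_structure F (B i)" if "i \<in> elts I" for i using B[OF that] K by auto
  define m where "m z = vfun I (\<lambda>i. e i (vapp z i))" for z
  have YA: "elts (carr Y) \<subseteq> elts (carr (product F I A))"
    and Yfn: "\<And>f xs. f \<in> elts (fsyms F) \<Longrightarrow> xs \<in> tuples (carr Y) (farity F f) \<Longrightarrow>
      fn Y f xs = fn (product F I A) f xs"
    using Y(2) by (auto simp: subalgebra_def)
  have mB: "m z \<in> elts (carr (product F I B))" if "z \<in> elts (carr Y)" for z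
    using that YA e(1) vapp_in_product[of z F I A] by (auto simp: m_def dest: homD(1))
  have inj: "inj_on m (elts (carr Y))"
  proof (rule inj_onI)
    fix z w assume zw: "z \<in> elts (carr Y)" "w \<in> elts (carr Y)" "m z = m w"
    then have PA: "z \<in> elts (carr (product F I A))" "w \<in> elts (carr (product F I A))" using YA by auto
    show "z = w"
    proof (rule product_eqI[OF PA])
      fix i assume i: "i \<in> elts I"
      have "e i (vapp z i) = e i (vapp w i)"
        using arg_cong[OF zw(3), of "\<lambda>z. vapp z i"] i by (simp add: m_def)
      then show "vapp z i = vapp w i"
        using e(2)[OF i] vapp_in_product[OF PA(1) i] vapp_in_product[OF PA(2) i] by (auto dest: inj_onD)
    qed
  qed
  have m_fn: "m (fn Y f ys) = fn (product F I B) f (map m ys)"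
    if f: "f \<in> elts (fsyms F)" and ys: "ys \<in> tuples (carr Y) (farity F f)" for f ys
  proof -
    have ysA: "ys \<in> tuples (carr (product F I A)) (farity F f)" using ys YA by (auto simp: tuples_def)
    have ysB: "map m ys \<in> tuples (carr (product F I B)) (farity F f)" using ys mB by (auto simp: tuples_def)
    have "m (fn Y f ys) = vfun I (\<lambda>i. e i (fn (A i) f (map (\<lambda>x. vapp x i) ys)))"
      unfolding m_def using f ys ysA by (intro vfun_cong) (simp add: Yfn fn_product)
    also have "\<dots> = vfun I (\<lambda>i. fn (B i) f (map (\<lambda>x. vapp x i) (map m ys)))"
    proof (rule vfun_cong)
      fix i assume i: "i \<in> elts I"
      have "map (\<lambda>x. vapp x i) (map m ys) = map (e i) (map (\<lambda>x. vapp x i) ys)"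
        using i by (simp add: m_def)
      then show "e i (fn (A i) f (map (\<lambda>x. vapp x i) ys)) = fn (B i) f (map (\<lambda>x. vapp x i) (map m ys))"
        using homD(2)[OF e(1)[OF i] f tuples_product_vapp[OF ysA i]] by (simp only:)
    qed
    also have "\<dots> = fn (product F I B) f (map m ys)" using f ysB by (simp add: fn_product)
    finally show ?thesis .
  qed
  define D where "D = vset (m ` elts (carr Y))"
  have D: "elts D = m ` elts (carr Y)" by (simp add: D_def)
  have tup: "\<exists>ys\<in>tuples (carr Y) n. xs = map m ys" if "xs \<in> tuples D n" for xs n
  proof -
    from that have "xs \<in> lists (m ` elts (carr Y))" by (auto simp: tuples_def D)
    then obtain ys where "ys \<in> lists (elts (carr Y))" "xs = map m ys" unfolding lists_image by blast
    with that show ?thesis by (intro bexI[of _ ys]) (auto simp: tuples_def)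
  qed
  \<comment> \<open>The image of \<open>Y\<close> under \<open>m\<close>, with operations cut down
    from the product and set to \<open>undefined\<close> off their domain, as
    \<open>is_structure\<close> demands.\<close>
  define Y' where "Y' = \<lparr>carr = D,
    fn = (\<lambda>f xs. if f \<in> elts (fsyms F) \<and> xs \<in> tuples D (farity F f) then fn (product F I B) f xs else undefined),
    rl = (\<lambda>r. {})\<rparr>"
  have Y'fn: "fn Y' f (map m ys) = m (fn Y f ys)"
    if "f \<in> elts (fsyms F)" "ys \<in> tuples (carr Y) (farity F f)" for f ys
    using that m_fn[OF that] by (auto simp: Y'_def tuples_def D)
  have "is_structure F Y'"
    unfolding is_structure_def
  proof (intro conjI allI)
    show "elts (carr Y') \<noteq> {}" using is_structure_nonempty[OF Y(1)] by (simp add: Y'_def D)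
    show "if f \<in> elts (fsyms F) \<and> xs \<in> tuples (carr Y') (farity F f)
             then fn Y' f xs \<in> elts (carr Y') else fn Y' f xs = undefined" for f xs
    proof (cases "f \<in> elts (fsyms F) \<and> xs \<in> tuples (carr Y') (farity F f)")
      case True
      then have f: "f \<in> elts (fsyms F)" and "xs \<in> tuples D (farity F f)" by (auto simp: Y'_def)
      then obtain ys where ys: "ys \<in> tuples (carr Y) (farity F f)" "xs = map m ys" using tup by blast
      then have "fn Y' f xs \<in> elts (carr Y')"
        using Y'fn[OF f ys(1)] is_structure_fn[OF Y(1) f ys(1)] by (simp add: Y'_def D)
      with True show ?thesis by simp
    qed (auto simp: Y'_def)
    show "if r \<in> elts (rsyms F) then rl Y' r \<subseteq> tuples (carr Y') (rarity F r) else rl Y' r = {}" for r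
      by (simp add: Y'_def)
  qed
  moreover have "subalgebra F Y' (product F I B)"
    using mB by (auto simp: subalgebra_def Y'_def D)
  moreover have "product F I B \<in> opP F K" using B by (auto simp: opP_def)
  ultimately have "Y' \<in> opS F (opP F K)" by (auto simp: opS_def)
  moreover have "surj_hom F Y' X"
    unfolding surj_hom_def
  proof
    \<comment> \<open>The given surjection \<open>h\<close> from \<open>Y\<close>, transported along
      the inverse of \<open>m\<close>.\<close>
    let ?g = "\<lambda>x. h (inv_into (elts (carr Y)) m x)"
    have g: "?g (m y) = h y" if "y \<in> elts (carr Y)" for y
      using that inj by simp
    show "?g ` elts (carr Y') = elts (carr X)"
      using g h(2) by (simp add: Y'_def D image_image)
    show "?g \<in> hom F Y' X"
      unfolding hom_def
    proof (intro CollectI conjI ballI)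
      show "?g \<in> elts (carr Y') \<rightarrow> elts (carr X)"
        using g homD(1)[OF h(1)] by (auto simp: Y'_def D)
      show "?g (fn Y' f xs) = fn X f (map ?g xs)"
        if f: "f \<in> elts (fsyms F)" and xs: "xs \<in> tuples (carr Y') (farity F f)" for f xs
      proof -
        from xs obtain ys where ys: "ys \<in> tuples (carr Y) (farity F f)" "xs = map m ys"
          using tup by (auto simp: Y'_def)
        have eq: "map ?g xs = map h ys" using g ys by (auto simp: tuples_def)
        show ?thesis
          unfolding eq
          using Y'fn[OF f ys(1)] g[OF is_structure_fn[OF Y(1) f ys(1)]] homD(2)[OF h(1) f ys(1)] ys(2) by simp
      qed
      show "map ?g xs \<in> rl X r" if "r \<in> elts (rsyms F)" "xs \<in> rl Y' r" for r xs
        using that by (simp add: Y'_def)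
    qed
  qed
  ultimately show "X \<in> HSP F K" using X(1) by (auto simp: HSP_def opH_def)
qed

lemma elts_powerset:
  fixes k :: "'v::zf_universe"
  shows "elts (vset {y. elts y \<subseteq> elts k}) = {y. elts y \<subseteq> elts k}"
  by (simp add: small_Pow)

text \<open>Links the power set inside the universe, which serves as index set, with the HOL power
  set, on which the independent functions live.\<close>

lemma bij_betw_elts_Pow: "bij_betw elts {y. elts y \<subseteq> elts k} (Pow (elts k))"
proof (rule bij_betw_byWitness[where f' = vset])
  show "\<forall>X\<in>Pow (elts k). elts (vset X) = X"
    by (auto simp only: Pow_iff intro!: elts_vset_small small_subset[OF small_elts])
  then show "vset ` Pow (elts k) \<subseteq> {y. elts y \<subseteq> elts k}" by auto
qed auto

section \<open>Ultraproducts\<close>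

text \<open>A maximal family with the finite intersection property is an ultrafilter. Intersecting
  with \<open>elts I\<close> gives the empty \<open>G\<close> its intended meaning, because
  \<open>\<Inter>{}\<close> is the whole type.\<close>

lemma ultrafilter_extension:
  fixes I :: "'v::zf_universe"
  assumes E: "E \<subseteq> Pow (elts I)"
    and fip: "\<And>G. finite G \<Longrightarrow> G \<subseteq> E \<Longrightarrow> elts I \<inter> \<Inter>G \<noteq> {}"
  shows "\<exists>U. ultrafilter I U \<and> E \<subseteq> elts ` elts U"
proof -
  let ?X = "elts I"
  define \<A> where "\<A> = {V. V \<subseteq> Pow ?X \<and> (\<forall>G. finite G \<longrightarrow> G \<subseteq> V \<longrightarrow> ?X \<inter> \<Inter>G \<noteq> {})}"
  have "\<exists>M\<in>{V \<in> \<A>. E \<subseteq> V}. \<forall>W\<in>{V \<in> \<A>. E \<subseteq> V}. M \<subseteq> W \<longrightarrow> W = M"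
  proof (rule subset_Zorn_nonempty)
    have "E \<in> {V \<in> \<A>. E \<subseteq> V}" using E fip by (simp add: \<A>_def)
    then show "{V \<in> \<A>. E \<subseteq> V} \<noteq> {}" by blast
    fix c assume c: "c \<noteq> {}" "subset.chain {V \<in> \<A>. E \<subseteq> V} c"
    have "V \<in> \<A> \<and> E \<subseteq> V" if "V \<in> c" for V
      using c(2) that unfolding subset_chain_def by auto
    then have cV: "\<And>V. V \<in> c \<Longrightarrow> V \<subseteq> Pow ?X" "\<And>V. V \<in> c \<Longrightarrow> E \<subseteq> V"
      "\<And>V G. V \<in> c \<Longrightarrow> finite G \<Longrightarrow> G \<subseteq> V \<Longrightarrow> ?X \<inter> \<Inter>G \<noteq> {}"
      by (simp_all add: \<A>_def)
    have "?X \<inter> \<Inter>G \<noteq> {}" if G: "finite G" "G \<subseteq> \<Union>c" for G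
    proof -
      from finite_subset_Union_chain[OF G c] obtain V where "V \<in> c" "G \<subseteq> V" .
      then show ?thesis using cV(3) G(1) by simp
    qed
    moreover have "\<Union>c \<subseteq> Pow ?X" using cV(1) by (rule Union_least)
    moreover have "E \<subseteq> \<Union>c" using cV(2) c(1) by fast
    ultimately show "\<Union>c \<in> {V \<in> \<A>. E \<subseteq> V}" by (simp add: \<A>_def)
  qed
  then obtain V where V': "V \<in> {V \<in> \<A>. E \<subseteq> V}" "\<forall>W\<in>{V \<in> \<A>. E \<subseteq> V}. V \<subseteq> W \<longrightarrow> W = V" ..
  then have V: "V \<in> \<A>" "E \<subseteq> V" by simp_all
  have max: "W = V" if "W \<in> \<A>" "V \<subseteq> W" for W
  proof -
    have "W \<in> {V \<in> \<A>. E \<subseteq> V}" using that V(2) by simp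
    with V'(2) that(2) show ?thesis by blast
  qed
  have VX: "V \<subseteq> Pow ?X" and Vfip: "\<And>G. finite G \<Longrightarrow> G \<subseteq> V \<Longrightarrow> ?X \<inter> \<Inter>G \<noteq> {}"
    using V(1) by (auto simp: \<A>_def)
  \<comment> \<open>By maximality a set outside \<open>V\<close> already clashes with finitely many
    members of \<open>V\<close>; closure under supersets and intersections and the choice between
    complements all follow from this.\<close>
  have new: "\<exists>G. finite G \<and> G \<subseteq> V \<and> ?X \<inter> \<Inter>G \<inter> Y = {}" if "Y \<subseteq> ?X" "Y \<notin> V" for Y
  proof (rule ccontr)
    assume *: "\<not> ?thesis"
    have "?X \<inter> \<Inter>G \<noteq> {}" if G: "finite G" "G \<subseteq> insert Y V" for G
    proof -
      have "finite (G - {Y})" "G - {Y} \<subseteq> V" using G by auto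
      with * have "?X \<inter> \<Inter>(G - {Y}) \<inter> Y \<noteq> {}" by blast
      then show ?thesis by blast
    qed
    then have "insert Y V \<in> \<A>" using VX that(1) by (simp add: \<A>_def)
    then have "insert Y V = V" by (rule max) blast
    with that(2) show False by blast
  qed
  have closed: "Y \<in> V" if G: "finite G" "G \<subseteq> V" "Y \<subseteq> ?X" "?X \<inter> \<Inter>G \<subseteq> Y" for G Y
  proof (rule ccontr)
    assume "Y \<notin> V"
    from new[OF G(3) this] obtain H where H: "finite H" "H \<subseteq> V" "?X \<inter> \<Inter>H \<inter> Y = {}" by blast
    have "?X \<inter> \<Inter>(G \<union> H) = {}" using G(4) H(3) by blast
    moreover have "?X \<inter> \<Inter>(G \<union> H) \<noteq> {}" using G H by (intro Vfip) auto
    ultimately show False by contradiction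
  qed
  have decide: "?X - Y \<in> V" if Y: "Y \<subseteq> ?X" "Y \<notin> V" for Y
  proof -
    from new[OF Y] obtain H where H: "finite H" "H \<subseteq> V" "?X \<inter> \<Inter>H \<inter> Y = {}" by blast
    show ?thesis by (rule closed[OF H(1,2)]) (use H(3) in blast)+
  qed
  \<comment> \<open>\<open>V\<close> is a HOL family of HOL sets and is coded as an element of the
    universe; this is possible because it consists of subsets of a set.\<close>
  define U where "U = vset (vset ` V)"
  have smallV: "small X" if "X \<in> V" for X
    using that VX by (auto intro: small_subset[OF small_elts])
  have "elts (vset X) \<subseteq> ?X" if "X \<in> V" for X
    using VX that smallV[OF that] by (simp add: subset_iff)
  then have "vset ` V \<subseteq> {y. elts y \<subseteq> ?X}" by blast
  then have "small (vset ` V)" by (rule small_subset[OF small_Pow[OF small_elts]])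
  then have U: "elts ` elts U = V" using smallV by (simp add: U_def image_image)
  have "ultrafilter I U"
    unfolding ultrafilter_def U
  proof (intro conjI ballI allI impI)
    show "X \<subseteq> ?X" if "X \<in> V" for X using that VX by blast
    show "?X \<in> V" by (rule closed[of "{}"]) auto
    show "{} \<notin> V" using Vfip[of "{{}}"] by auto
    show "X \<inter> Y \<in> V" if "X \<in> V" "Y \<in> V" for X Y
      using that VX by (intro closed[of "{X, Y}"]) auto
    show "Y \<in> V" if "X \<in> V" "X \<subseteq> Y \<and> Y \<subseteq> ?X" for X Y
      using that by (intro closed[of "{X}"]) auto
    show "X \<in> V \<or> ?X - X \<in> V" if "X \<subseteq> ?X" for X
      using decide[OF that] by blast
  qed
  with V(2) U show ?thesis by blast
qed

lemma ultrafilterD: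
  assumes "ultrafilter I U"
  shows ultrafilter_UNIV: "elts I \<in> elts ` elts U"
    and ultrafilter_nonempty: "{} \<notin> elts ` elts U"
    and ultrafilter_Int: "\<And>X Y. X \<in> elts ` elts U \<Longrightarrow> Y \<in> elts ` elts U \<Longrightarrow> X \<inter> Y \<in> elts ` elts U"
    and ultrafilter_mono: "\<And>X Y. X \<in> elts ` elts U \<Longrightarrow> X \<subseteq> Y \<Longrightarrow> Y \<subseteq> elts I \<Longrightarrow> Y \<in> elts ` elts U"
proof -
  define V where "V = elts ` elts U"
  have "elts I \<in> V \<and> {} \<notin> V \<and> (\<forall>X\<in>V. \<forall>Y\<in>V. X \<inter> Y \<in> V) \<and> (\<forall>X\<in>V. \<forall>Y. X \<subseteq> Y \<and> Y \<subseteq> elts I \<longrightarrow> Y \<in> V)"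
    using assms unfolding ultrafilter_def V_def by (elim conjE) (intro conjI)
  then have "elts I \<in> V" "{} \<notin> V" "\<And>X Y. X \<in> V \<Longrightarrow> Y \<in> V \<Longrightarrow> X \<inter> Y \<in> V"
    "\<And>X Y. X \<in> V \<Longrightarrow> X \<subseteq> Y \<Longrightarrow> Y \<subseteq> elts I \<Longrightarrow> Y \<in> V" by simp_all
  note * = this[unfolded V_def]
  show "elts I \<in> elts ` elts U" by (rule *(1))
  show "{} \<notin> elts ` elts U" by (rule *(2))
  show "X \<inter> Y \<in> elts ` elts U" if "X \<in> elts ` elts U" "Y \<in> elts ` elts U" for X Y
    using that by (rule *(3))
  show "Y \<in> elts ` elts U" if "X \<in> elts ` elts U" "X \<subseteq> Y" "Y \<subseteq> elts I" for X Y
    using that by (rule *(4))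
qed

text \<open>The quantifier "for almost all indices"; its closure rules replace computations with
  members of the ultrafilter by pointwise reasoning.\<close>

definition ae :: "'v::zf_universe \<Rightarrow> 'v \<Rightarrow> ('v \<Rightarrow> bool) \<Rightarrow> bool" where
  "ae I U Q \<longleftrightarrow> {i \<in> elts I. Q i} \<in> elts ` elts U"

lemma ae_mono:
  assumes "ultrafilter I U" "ae I U Q" "\<And>i. i \<in> elts I \<Longrightarrow> Q i \<Longrightarrow> R i"
  shows "ae I U R"
  using ultrafilter_mono[OF assms(1), of "{i \<in> elts I. Q i}" "{i \<in> elts I. R i}"] assms(2,3)
  unfolding ae_def by blast

lemma ae_conj:
  assumes "ultrafilter I U" "ae I U Q" "ae I U R"
  shows "ae I U (\<lambda>i. Q i \<and> R i)"
proof -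
  have "{i \<in> elts I. Q i} \<inter> {i \<in> elts I. R i} = {i \<in> elts I. Q i \<and> R i}" by blast
  then show ?thesis
    using ultrafilter_Int[OF assms(1), of "{i \<in> elts I. Q i}" "{i \<in> elts I. R i}"] assms(2,3)
    unfolding ae_def by simp
qed

lemma ae_all:
  assumes "ultrafilter I U" "\<And>i. i \<in> elts I \<Longrightarrow> Q i"
  shows "ae I U Q"
proof -
  have "{i \<in> elts I. Q i} = elts I" using assms(2) by blast
  then show ?thesis using ultrafilter_UNIV[OF assms(1)] by (simp add: ae_def)
qed

lemma ae_list:
  assumes "ultrafilter I U" "\<And>x. x \<in> set xs \<Longrightarrow> ae I U (Q x)"
  shows "ae I U (\<lambda>i. \<forall>x\<in>set xs. Q x i)"
  using assms(2)
proof (induction xs)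
  case Nil
  then show ?case using ae_all[OF assms(1)] by simp
next
  case (Cons x xs)
  then have "ae I U (Q x)" "ae I U (\<lambda>i. \<forall>x\<in>set xs. Q x i)" by simp_all
  from ae_conj[OF assms(1) this] show ?case by simp
qed

lemma ae_iff:
  assumes "ultrafilter I U" "ae I U (\<lambda>i. Q i \<longleftrightarrow> R i)"
  shows "ae I U Q \<longleftrightarrow> ae I U R"
proof
  assume "ae I U Q"
  from ae_conj[OF assms(1) this assms(2)] show "ae I U R" by (rule ae_mono[OF assms(1)]) blast
next
  assume "ae I U R"
  from ae_conj[OF assms(1) this assms(2)] show "ae I U Q" by (rule ae_mono[OF assms(1)]) blast
qed

section \<open>Ultraproducts as quotients of direct products\<close>

definition ueq :: "'v::zf_universe \<Rightarrow> 'v \<Rightarrow> 'v \<Rightarrow> 'v \<Rightarrow> bool" where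
  "ueq I U z w \<longleftrightarrow> ae I U (\<lambda>i. vapp z i = vapp w i)"

lemma ueq_refl: "ultrafilter I U \<Longrightarrow> ueq I U z z"
  by (simp add: ueq_def ae_all)

lemma ueq_sym: "ueq I U z w \<Longrightarrow> ueq I U w z"
  by (simp add: ueq_def eq_commute)

lemma ueq_trans:
  assumes "ultrafilter I U" "ueq I U z w" "ueq I U w x"
  shows "ueq I U z x"
  using ae_conj[OF assms(1) assms(2,3)[unfolded ueq_def]] unfolding ueq_def
  by (rule ae_mono[OF assms(1)]) simp

lemma elts_uclass:
  "elts (uclass L I U P z) = {w \<in> elts (carr (product L I P)). ueq I U z w}"
  unfolding uclass_def ueq_def ae_def
  by (rule elts_vset_small, rule small_subset[OF small_elts]) blast

lemma uclass_eq_iff: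
  assumes U: "ultrafilter I U"
    and z: "z \<in> elts (carr (product L I P))" and w: "w \<in> elts (carr (product L I P))"
  shows "uclass L I U P z = uclass L I U P w \<longleftrightarrow> ueq I U z w"
proof
  assume "uclass L I U P z = uclass L I U P w"
  then have "w \<in> elts (uclass L I U P z)" using w U by (simp add: elts_uclass ueq_refl)
  then show "ueq I U z w" by (simp add: elts_uclass)
next
  assume "ueq I U z w"
  then show "uclass L I U P z = uclass L I U P w"
    by (intro extensionality) (auto simp: elts_uclass intro: ueq_trans[OF U] ueq_sym)
qed

lemma urep_uclass:
  assumes U: "ultrafilter I U" and z: "z \<in> elts (carr (product L I P))"
  shows "urep (uclass L I U P z) \<in> elts (carr (product L I P))"
    and "ueq I U z (urep (uclass L I U P z))"
proof -
  have "z \<in> elts (uclass L I U P z)" using z U by (simp add: elts_uclass ueq_refl)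
  then have "urep (uclass L I U P z) \<in> elts (uclass L I U P z)"
    unfolding urep_def by (rule someI)
  then show "urep (uclass L I U P z) \<in> elts (carr (product L I P))"
    and "ueq I U z (urep (uclass L I U P z))" by (simp_all add: elts_uclass)
qed

lemma elts_carr_ultraproduct:
  "elts (carr (ultraproduct L I U P)) = uclass L I U P ` elts (carr (product L I P))"
  by (simp add: ultraproduct_def Let_def)

lemma urep_in_product:
  assumes "ultrafilter I U" "c \<in> elts (carr (ultraproduct L I U P))"
  shows "urep c \<in> elts (carr (product L I P))"
  using assms urep_uclass(1)[OF assms(1)] by (auto simp: elts_carr_ultraproduct)

lemma uclass_urep:
  assumes "ultrafilter I U" "c \<in> elts (carr (ultraproduct L I U P))"
  shows "uclass L I U P (urep c) = c"
proof -
  obtain z where z: "z \<in> elts (carr (product L I P))" "c = uclass L I U P z"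
    using assms(2) by (auto simp: elts_carr_ultraproduct)
  then show ?thesis
    using uclass_eq_iff[OF assms(1) z(1) urep_uclass(1)[OF assms(1) z(1)]] urep_uclass(2)[OF assms(1) z(1)]
    by simp
qed

lemma fn_ultraproduct:
  assumes "f \<in> elts (fsyms L)" "cs \<in> tuples (carr (ultraproduct L I U P)) (farity L f)"
  shows "fn (ultraproduct L I U P) f cs = uclass L I U P (fn (product L I P) f (map urep cs))"
  using assms by (simp add: ultraproduct_def Let_def)

lemma rl_ultraproduct:
  assumes "r \<in> elts (rsyms L)" "cs \<in> tuples (carr (ultraproduct L I U P)) (rarity L r)"
  shows "cs \<in> rl (ultraproduct L I U P) r \<longleftrightarrow> ae I U (\<lambda>i. map (\<lambda>c. vapp (urep c) i) cs \<in> rl (P i) r)"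
  using assms by (simp add: ultraproduct_def Let_def ae_def)

lemma rl_ultraproduct_tuples:
  "r \<in> elts (rsyms L) \<Longrightarrow> rl (ultraproduct L I U P) r \<subseteq> tuples (carr (ultraproduct L I U P)) (rarity L r)"
  by (auto simp: ultraproduct_def Let_def)

lemma map_urep_tuples:
  assumes "ultrafilter I U" "cs \<in> tuples (carr (ultraproduct L I U P)) n"
  shows "map urep cs \<in> tuples (carr (product L I P)) n"
  using assms urep_in_product[OF assms(1)] by (auto simp: tuples_def)

lemma fn_ultraproduct_closed:
  assumes "ultrafilter I U" "\<And>i. i \<in> elts I \<Longrightarrow> is_structure L (P i)"
    "f \<in> elts (fsyms L)" "cs \<in> tuples (carr (ultraproduct L I U P)) (farity L f)"
  shows "fn (ultraproduct L I U P) f cs \<in> elts (carr (ultraproduct L I U P))"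
  unfolding fn_ultraproduct[OF assms(3,4)] elts_carr_ultraproduct
  by (intro imageI fn_product_closed assms(2,3) map_urep_tuples[OF assms(1,4)])

text \<open>The diagonal embedding into the ultrapower. It is injective because constant functions
  that agree almost everywhere agree at some index, \<open>{}\<close> not being in the
  ultrafilter.\<close>

lemma inj_hom_ultrapower:
  assumes F: "algebraic F" and U: "ultrafilter I U" and A: "is_structure F A"
  shows "inj_hom F A (ultraproduct F I U (\<lambda>_. A))"
proof -
  let ?P = "\<lambda>_. A"
  define d where "d a = vfun I (\<lambda>_. a)" for a
  define h where "h a = uclass F I U ?P (d a)" for a
  have d: "d a \<in> elts (carr (product F I ?P))" if "a \<in> elts (carr A)" for a
    using that by (simp add: d_def)
  have h: "h a \<in> elts (carr (ultraproduct F I U ?P))" if "a \<in> elts (carr A)" for a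
    using d[OF that] by (simp add: h_def elts_carr_ultraproduct)
  have hom: "h (fn A f xs) = fn (ultraproduct F I U ?P) f (map h xs)"
    if f: "f \<in> elts (fsyms F)" and xs: "xs \<in> tuples (carr A) (farity F f)" for f xs
  proof -
    have hxs: "map h xs \<in> tuples (carr (ultraproduct F I U ?P)) (farity F f)"
      using xs h by (auto simp: tuples_def)
    note m = map_urep_tuples[OF U hxs]
    \<comment> \<open>The operations of the ultrapower are computed on chosen representatives, which
      need not be constant; almost everywhere they have the constant values, simultaneously for the
      finitely many arguments.\<close>
    have "ae I U (\<lambda>i. \<forall>x\<in>set xs. x = vapp (urep (h x)) i)"
    proof (rule ae_list[OF U])
      fix x assume "x \<in> set xs"
      then have "x \<in> elts (carr A)" using xs by (auto simp: tuples_def)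
      from urep_uclass(2)[OF U d[OF this]] have "ueq I U (d x) (urep (h x))" by (simp add: h_def)
      then show "ae I U (\<lambda>i. x = vapp (urep (h x)) i)"
        unfolding ueq_def by (rule ae_mono[OF U]) (simp add: d_def)
    qed
    then have "ueq I U (d (fn A f xs)) (fn (product F I ?P) f (map urep (map h xs)))"
      unfolding ueq_def
    proof (rule ae_mono[OF U])
      fix i assume i: "i \<in> elts I" "\<forall>x\<in>set xs. x = vapp (urep (h x)) i"
      then have "map (\<lambda>x. vapp x i) (map urep (map h xs)) = xs" by (simp add: map_idI)
      then show "vapp (d (fn A f xs)) i = vapp (fn (product F I ?P) f (map urep (map h xs))) i"
        unfolding fn_product[OF f m] vapp_vfun[OF i(1)] d_def by (simp only:)
    qed
    then have "h (fn A f xs) = uclass F I U ?P (fn (product F I ?P) f (map urep (map h xs)))"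
      unfolding h_def[of "fn A f xs"]
      by (subst uclass_eq_iff[OF U]) (intro d is_structure_fn[OF A f xs] fn_product_closed A f m)+
    also have "\<dots> = fn (ultraproduct F I U ?P) f (map h xs)"
      by (rule fn_ultraproduct[OF f hxs, symmetric])
    finally show ?thesis .
  qed
  have "inj_on h (elts (carr A))"
  proof (rule inj_onI)
    fix a b assume ab: "a \<in> elts (carr A)" "b \<in> elts (carr A)" "h a = h b"
    then have "ueq I U (d a) (d b)" using uclass_eq_iff[OF U d[OF ab(1)] d[OF ab(2)]] by (simp add: h_def)
    then have "{i \<in> elts I. vapp (d a) i = vapp (d b) i} \<noteq> {}"
      using ultrafilter_nonempty[OF U] unfolding ueq_def ae_def by metis
    then show "a = b" by (auto simp: d_def)
  qed
  moreover have "h \<in> hom F A (ultraproduct F I U ?P)"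
    unfolding hom_def using h hom F by (auto simp: algebraic_def)
  ultimately show ?thesis unfolding inj_hom_def by blast
qed

section \<open>Isomorphisms from relations between direct products\<close>

text \<open>That the inverse is a homomorphism follows from bijectivity for the operations, and for
  the relations from the equivalence in \<open>rlA\<close>; \<open>rlB\<close> ensures that related
  lists of \<open>B\<close> can be pulled back.\<close>

lemma isomorphicI:
  assumes A: "is_structure L A"
    and h: "bij_betw h (elts (carr A)) (elts (carr B))"
    and fn: "\<And>f xs. f \<in> elts (fsyms L) \<Longrightarrow> xs \<in> tuples (carr A) (farity L f) \<Longrightarrow> h (fn A f xs) = fn B f (map h xs)"
    and rlA: "\<And>r xs. r \<in> elts (rsyms L) \<Longrightarrow> xs \<in> tuples (carr A) (rarity L r) \<Longrightarrow> xs \<in> rl A r \<longleftrightarrow> map h xs \<in> rl B r"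
    and rlB: "\<And>r. r \<in> elts (rsyms L) \<Longrightarrow> rl B r \<subseteq> tuples (carr B) (rarity L r)"
  shows "isomorphic L A B"
proof -
  let ?k = "inv_into (elts (carr A)) h"
  have inj: "inj_on h (elts (carr A))" and im: "h ` elts (carr A) = elts (carr B)"
    using h by (auto simp: bij_betw_def)
  have rl_tuples: "rl A r \<subseteq> tuples (carr A) (rarity L r)" if "r \<in> elts (rsyms L)" for r
    using A that by (auto simp: is_structure_def split: if_splits)
  have k: "map ?k ys \<in> tuples (carr A) n \<and> map h (map ?k ys) = ys" if "ys \<in> tuples (carr B) n" for ys n
    using that im by (auto simp: tuples_def inv_into_into f_inv_into_f subset_iff intro!: map_idI)
  have "h \<in> hom L A B"
    unfolding hom_def
  proof (intro CollectI conjI ballI)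
    show "map h xs \<in> rl B r" if "r \<in> elts (rsyms L)" "xs \<in> rl A r" for r xs
      using that rlA rl_tuples by blast
  qed (use im fn in auto)
  moreover have "?k \<in> hom L B A"
    unfolding hom_def
  proof (intro CollectI conjI ballI)
    show "?k \<in> elts (carr B) \<rightarrow> elts (carr A)" using im by (auto intro: inv_into_into)
    show "?k (fn B f ys) = fn A f (map ?k ys)"
      if f: "f \<in> elts (fsyms L)" and ys: "ys \<in> tuples (carr B) (farity L f)" for f ys
    proof -
      have "fn B f ys = h (fn A f (map ?k ys))"
        using fn[OF f] k[OF ys] by simp
      moreover have "fn A f (map ?k ys) \<in> elts (carr A)"
        using k[OF ys] by (intro is_structure_fn[OF A f]) simp
      ultimately show ?thesis using inj by simp
    qed
    show "map ?k ys \<in> rl A r" if r: "r \<in> elts (rsyms L)" and ys: "ys \<in> rl B r" for r ys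
    proof -
      have "ys \<in> tuples (carr B) (rarity L r)" using rlB[OF r] ys by blast
      from k[OF this] rlA[OF r, of "map ?k ys"] ys show ?thesis by metis
    qed
  qed
  ultimately show ?thesis using h unfolding isomorphic_def by blast
qed

lemma is_structure_ultraproduct:
  assumes U: "ultrafilter I U" and P: "\<And>i. i \<in> elts I \<Longrightarrow> is_structure L (P i)"
  shows "is_structure L (ultraproduct L I U P)"
proof -
  have "elts (carr (ultraproduct L I U P)) \<noteq> {}"
    using is_structure_nonempty[OF is_structure_product[of I L P]] P
    unfolding elts_carr_ultraproduct by simp
  moreover have "fn (ultraproduct L I U P) f xs = undefined"
    if "\<not> (f \<in> elts (fsyms L) \<and> xs \<in> tuples (carr (ultraproduct L I U P)) (farity L f))" for f xs
    using that by (auto simp: ultraproduct_def Let_def)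
  moreover have "if r \<in> elts (rsyms L) then rl (ultraproduct L I U P) r \<subseteq> tuples (carr (ultraproduct L I U P)) (rarity L r)
          else rl (ultraproduct L I U P) r = {}" for r
    by (auto simp: ultraproduct_def Let_def)
  ultimately show ?thesis
    using fn_ultraproduct_closed[OF U P] unfolding is_structure_def by simp
qed

text \<open>\<open>R\<close> need not be a function: totality on both sides and agreement of
  equalities make it a bijection of classes, and agreement of the other atomic facts makes that
  bijection an isomorphism. Operations enter through their graphs, hence the additional pair
  \<open>(z, w)\<close> for the value.\<close>

lemma ultraproducts_isomorphic:
  assumes U: "ultrafilter I U"
    and P: "\<And>i. i \<in> elts I \<Longrightarrow> is_structure L (P i)" and Q: "\<And>i. i \<in> elts I \<Longrightarrow> is_structure L (Q i)"
    and R: "R \<subseteq> elts (carr (product L I P)) \<times> elts (carr (product L I Q))"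
    and left: "\<And>z. z \<in> elts (carr (product L I P)) \<Longrightarrow> \<exists>w. (z, w) \<in> R"
    and right: "\<And>w. w \<in> elts (carr (product L I Q)) \<Longrightarrow> \<exists>z. (z, w) \<in> R"
    and eq: "\<And>z w z' w'. (z, w) \<in> R \<Longrightarrow> (z', w') \<in> R \<Longrightarrow>
      ae I U (\<lambda>i. vapp z i = vapp z' i \<longleftrightarrow> vapp w i = vapp w' i)"
    and fn: "\<And>f ps z w. f \<in> elts (fsyms L) \<Longrightarrow> set ps \<subseteq> R \<Longrightarrow> length ps = farity L f \<Longrightarrow> (z, w) \<in> R \<Longrightarrow>
      ae I U (\<lambda>i. fn (P i) f (map (\<lambda>p. vapp (fst p) i) ps) = vapp z i \<longleftrightarrow>
                  fn (Q i) f (map (\<lambda>p. vapp (snd p) i) ps) = vapp w i)"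
    and rl: "\<And>r ps. r \<in> elts (rsyms L) \<Longrightarrow> set ps \<subseteq> R \<Longrightarrow> length ps = rarity L r \<Longrightarrow>
      ae I U (\<lambda>i. map (\<lambda>p. vapp (fst p) i) ps \<in> rl (P i) r \<longleftrightarrow> map (\<lambda>p. vapp (snd p) i) ps \<in> rl (Q i) r)"
  shows "isomorphic L (ultraproduct L I U P) (ultraproduct L I U Q)"
proof -
  let ?A = "ultraproduct L I U P" and ?B = "ultraproduct L I U Q"
  let ?p = "product L I P" and ?q = "product L I Q"
  define g where "g z = (SOME w. (z, w) \<in> R)" for z
  have g: "(z, g z) \<in> R" "g z \<in> elts (carr ?q)" if "z \<in> elts (carr ?p)" for z
  proof -
    show "(z, g z) \<in> R" unfolding g_def by (rule someI_ex[OF left[OF that]])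
    then show "g z \<in> elts (carr ?q)" using R by blast
  qed
  have ueq: "ueq I U z z' \<longleftrightarrow> ueq I U w w'" if "(z, w) \<in> R" "(z', w') \<in> R" for z w z' w'
    unfolding ueq_def by (rule ae_iff[OF U eq[OF that]])
  define h where "h c = uclass L I U Q (g (urep c))" for c
  have hB: "h c \<in> elts (carr ?B)" if "c \<in> elts (carr ?A)" for c
    using g(2)[OF urep_in_product[OF U that]] by (simp add: h_def elts_carr_ultraproduct)
  have urep_h: "ueq I U (g (urep c)) (urep (h c))" if "c \<in> elts (carr ?A)" for c
    unfolding h_def by (rule urep_uclass(2)[OF U g(2)[OF urep_in_product[OF U that]]])
  \<comment> \<open>The map \<open>h\<close> can be computed from any pair in \<open>R\<close>, not
    only from the chosen partner of a chosen representative.\<close>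
  have h_uclass: "h (uclass L I U P z) = uclass L I U Q w" if zw: "(z, w) \<in> R" for z w
  proof -
    have z: "z \<in> elts (carr ?p)" "w \<in> elts (carr ?q)" using zw R by auto
    note u = urep_uclass[OF U z(1)]
    show ?thesis
      unfolding h_def uclass_eq_iff[OF U g(2)[OF u(1)] z(2)]
      using ueq[OF zw g(1)[OF u(1)]] u(2) by (auto intro: ueq_sym)
  qed
  have atomic: "\<And>f. f \<in> elts (fsyms L) \<Longrightarrow> n = farity L f \<Longrightarrow> h (fn ?A f cs) = fn ?B f (map h cs)"
    "\<And>r. r \<in> elts (rsyms L) \<Longrightarrow> n = rarity L r \<Longrightarrow> cs \<in> rl ?A r \<longleftrightarrow> map h cs \<in> rl ?B r"
    if cs: "cs \<in> tuples (carr ?A) n" for cs n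
  proof -
    define ps where "ps = map (\<lambda>c. (urep c, g (urep c))) cs"
    have csA: "c \<in> elts (carr ?A)" if "c \<in> set cs" for c using cs that by (auto simp: tuples_def)
    have ps: "set ps \<subseteq> R" "length ps = n"
      using cs csA g(1)[OF urep_in_product[OF U]] by (auto simp: ps_def tuples_def)
    have hcs: "map h cs \<in> tuples (carr ?B) n" using cs hB by (auto simp: tuples_def)
    have fstps: "map (\<lambda>p. vapp (fst p) i) ps = map (\<lambda>c. vapp (urep c) i) cs" for i
      by (simp add: ps_def)
    have sndps: "ae I U (\<lambda>i. map (\<lambda>p. vapp (snd p) i) ps = map (\<lambda>d. vapp (urep d) i) (map h cs))"
    proof -
      have "ae I U (\<lambda>i. \<forall>c\<in>set cs. vapp (g (urep c)) i = vapp (urep (h c)) i)"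
        by (rule ae_list[OF U]) (rule urep_h[OF csA, unfolded ueq_def])
      then show ?thesis by (rule ae_mono[OF U]) (simp add: ps_def)
    qed
    show "h (fn ?A f cs) = fn ?B f (map h cs)" if f: "f \<in> elts (fsyms L)" and n: "n = farity L f" for f
    proof -
      let ?x = "fn ?p f (map urep cs)" and ?y = "fn ?q f (map urep (map h cs))"
      note csf = cs[unfolded n] and hcsf = hcs[unfolded n]
      note tx = map_urep_tuples[OF U csf] and ty = map_urep_tuples[OF U hcsf]
      have x: "?x \<in> elts (carr ?p)" using P f tx by (rule fn_product_closed)
      have y: "?y \<in> elts (carr ?q)" using Q f ty by (rule fn_product_closed)
      \<comment> \<open>The graph condition is applied to the pair \<open>(?x, g ?x)\<close>. Its
        left side holds everywhere, so almost everywhere \<open>g ?x\<close> is the value of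
        \<open>f\<close> at the partners of the arguments.\<close>
      have "ae I U (\<lambda>i. fn (P i) f (map (\<lambda>p. vapp (fst p) i) ps) = vapp ?x i)"
        unfolding fstps by (rule ae_all[OF U]) (simp add: fn_product[OF f tx] comp_def)
      then have "ae I U (\<lambda>i. fn (Q i) f (map (\<lambda>p. vapp (snd p) i) ps) = vapp (g ?x) i)"
        using ae_iff[OF U fn[OF f ps(1) ps(2)[unfolded n] g(1)[OF x]]] by simp
      from ae_conj[OF U this sndps] have "ueq I U (g ?x) ?y"
        unfolding ueq_def
      proof (rule ae_mono[OF U])
        fix i assume i: "i \<in> elts I" and *: "fn (Q i) f (map (\<lambda>p. vapp (snd p) i) ps) = vapp (g ?x) i \<and>
          map (\<lambda>p. vapp (snd p) i) ps = map (\<lambda>d. vapp (urep d) i) (map h cs)"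
        have "vapp ?y i = fn (Q i) f (map (\<lambda>d. vapp (urep d) i) (map h cs))"
          unfolding fn_product[OF f ty] vapp_vfun[OF i] by (simp add: comp_def)
        with * show "vapp (g ?x) i = vapp ?y i" by metis
      qed
      then have "uclass L I U Q (g ?x) = uclass L I U Q ?y"
        unfolding uclass_eq_iff[OF U g(2)[OF x] y] .
      then show ?thesis
        unfolding fn_ultraproduct[OF f csf] fn_ultraproduct[OF f hcsf] h_uclass[OF g(1)[OF x]] .
    qed
    show "cs \<in> rl ?A r \<longleftrightarrow> map h cs \<in> rl ?B r" if r: "r \<in> elts (rsyms L)" and n: "n = rarity L r" for r
    proof -
      have "cs \<in> rl ?A r \<longleftrightarrow> ae I U (\<lambda>i. map (\<lambda>p. vapp (fst p) i) ps \<in> rl (P i) r)"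
        unfolding rl_ultraproduct[OF r cs[unfolded n]] fstps ..
      also have "\<dots> \<longleftrightarrow> ae I U (\<lambda>i. map (\<lambda>p. vapp (snd p) i) ps \<in> rl (Q i) r)"
        by (rule ae_iff[OF U rl[OF r ps(1) ps(2)[unfolded n]]])
      also have "\<dots> \<longleftrightarrow> ae I U (\<lambda>i. map (\<lambda>d. vapp (urep d) i) (map h cs) \<in> rl (Q i) r)"
        by (rule ae_iff[OF U], rule ae_mono[OF U sndps]) (simp only:)
      also have "\<dots> \<longleftrightarrow> map h cs \<in> rl ?B r"
        unfolding rl_ultraproduct[OF r hcs[unfolded n]] ..
      finally show ?thesis .
    qed
  qed
  show ?thesis
  proof (rule isomorphicI)
    show "is_structure L ?A" using U P by (rule is_structure_ultraproduct)
    show "rl ?B r \<subseteq> tuples (carr ?B) (rarity L r)" if "r \<in> elts (rsyms L)" for r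
      by (rule rl_ultraproduct_tuples[OF that])
    show "bij_betw h (elts (carr ?A)) (elts (carr ?B))"
      unfolding bij_betw_def
    proof (intro conjI inj_onI subset_antisym subsetI)
      fix c c' assume c: "c \<in> elts (carr ?A)" "c' \<in> elts (carr ?A)" "h c = h c'"
      note u = urep_in_product[OF U c(1)] urep_in_product[OF U c(2)]
      have "ueq I U (g (urep c)) (g (urep c'))"
        using c(3) unfolding h_def uclass_eq_iff[OF U g(2)[OF u(1)] g(2)[OF u(2)]] .
      then have "ueq I U (urep c) (urep c')" using ueq[OF g(1)[OF u(1)] g(1)[OF u(2)]] by simp
      then have "uclass L I U P (urep c) = uclass L I U P (urep c')"
        unfolding uclass_eq_iff[OF U u] .
      then show "c = c'" by (simp only: uclass_urep[OF U c(1)] uclass_urep[OF U c(2)])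
    next
      fix d assume "d \<in> h ` elts (carr ?A)" then show "d \<in> elts (carr ?B)" using hB by blast
    next
      fix d assume "d \<in> elts (carr ?B)"
      then obtain w where w: "w \<in> elts (carr ?q)" "d = uclass L I U Q w"
        by (auto simp: elts_carr_ultraproduct)
      from right[OF w(1)] obtain z where z: "(z, w) \<in> R" by blast
      then have "uclass L I U P z \<in> elts (carr ?A)" using R by (auto simp: elts_carr_ultraproduct)
      then show "d \<in> h ` elts (carr ?A)" using h_uclass[OF z] w(2) by (intro image_eqI[of _ _ "uclass L I U P z"]) simp_all
    qed
  qed (simp_all only: atomic)
qed

section \<open>Back-and-forth games\<close>

text \<open>The clause for \<open>f\<close> compares values only when the proposed value belongs to
  the position. Positions therefore need not be closed under the operations and can stay
  finite.\<close>

definition partial_iso ::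
  "'v::zf_universe signature \<Rightarrow> 'v set \<Rightarrow> 'v set \<Rightarrow> 'v struc \<Rightarrow> 'v struc \<Rightarrow> ('v \<times> 'v) set \<Rightarrow> bool" where
  "partial_iso L Fs Rs P Q \<rho> \<longleftrightarrow>
     (\<forall>p\<in>\<rho>. \<forall>q\<in>\<rho>. fst p = fst q \<longleftrightarrow> snd p = snd q) \<and>
     (\<forall>f\<in>Fs. \<forall>ps q. set ps \<subseteq> \<rho> \<longrightarrow> length ps = farity L f \<longrightarrow> q \<in> \<rho> \<longrightarrow>
        (fn P f (map fst ps) = fst q \<longleftrightarrow> fn Q f (map snd ps) = snd q)) \<and>
     (\<forall>r\<in>Rs. \<forall>ps. set ps \<subseteq> \<rho> \<longrightarrow> length ps = rarity L r \<longrightarrow>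
        (map fst ps \<in> rl P r \<longleftrightarrow> map snd ps \<in> rl Q r))"

text \<open>Duplicator wins the game of length \<open>n\<close> on the reducts to \<open>Fs\<close> and \<open>Rs\<close> from the position
  \<open>\<rho>\<close>; function symbols are treated as relations.\<close>

primrec back_and_forth ::
  "'v::zf_universe signature \<Rightarrow> 'v set \<Rightarrow> 'v set \<Rightarrow> nat \<Rightarrow> 'v struc \<Rightarrow> 'v struc \<Rightarrow> ('v \<times> 'v) set \<Rightarrow> bool" where
  "back_and_forth L Fs Rs 0 P Q \<rho> \<longleftrightarrow> partial_iso L Fs Rs P Q \<rho>"
| "back_and_forth L Fs Rs (Suc n) P Q \<rho> \<longleftrightarrow> back_and_forth L Fs Rs n P Q \<rho> \<and>
     (\<forall>a\<in>elts (carr P). \<exists>b\<in>elts (carr Q). back_and_forth L Fs Rs n P Q (insert (a, b) \<rho>)) \<and>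
     (\<forall>b\<in>elts (carr Q). \<exists>a\<in>elts (carr P). back_and_forth L Fs Rs n P Q (insert (a, b) \<rho>))"

lemma partial_iso_mono:
  assumes "partial_iso L Fs Rs P Q \<rho>" "\<rho>' \<subseteq> \<rho>" "Fs' \<subseteq> Fs" "Rs' \<subseteq> Rs"
  shows "partial_iso L Fs' Rs' P Q \<rho>'"
  using assms unfolding partial_iso_def by (meson subset_trans subsetD)

lemma back_and_forth_mono:
  assumes "back_and_forth L Fs Rs n P Q \<rho>" "\<rho>' \<subseteq> \<rho>" "Fs' \<subseteq> Fs" "Rs' \<subseteq> Rs"
  shows "back_and_forth L Fs' Rs' n P Q \<rho>'"
  using assms(1,2)
proof (induction n arbitrary: \<rho> \<rho>')
  case 0
  then show ?case using assms(3,4) by (auto intro: partial_iso_mono)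
next
  case (Suc n)
  have "insert x \<rho>' \<subseteq> insert x \<rho>" for x using Suc.prems(2) by blast
  with Suc show ?case by (simp, meson)
qed

lemma back_and_forth_le:
  assumes "m \<le> n" "back_and_forth L Fs Rs n P Q \<rho>"
  shows "back_and_forth L Fs Rs m P Q \<rho>"
  using assms by (induction n) (auto simp: le_Suc_eq)

section \<open>Formulas that decide a game\<close>

text \<open>The conjunction that decides every formula of \<open>hs\<close> as \<open>S\<close>
  does. The syntax has no truth constant, so a valid formula \<open>b\<close> is supplied to start
  the conjunction.\<close>

definition pattern_fm :: "'v fm \<Rightarrow> 'v fm list \<Rightarrow> 'v fm set \<Rightarrow> 'v fm" where
  "pattern_fm b hs S = foldr (\<lambda>p. Conj (if p \<in> S then p else Neg p)) hs b"

lemma sat_pattern_fm: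
  "sat P e (pattern_fm b hs S) \<longleftrightarrow> sat P e b \<and> (\<forall>p\<in>set hs. sat P e p \<longleftrightarrow> p \<in> S)"
  by (induction hs) (auto simp: pattern_fm_def)

lemma wf_pattern_fm:
  "wf_fm L b \<Longrightarrow> (\<forall>p\<in>set hs. wf_fm L p) \<Longrightarrow> wf_fm L (pattern_fm b hs S)"
  by (induction hs) (auto simp: pattern_fm_def)

lemma fv_pattern_fm: "fv (pattern_fm b hs S) = fv b \<union> \<Union> (fv ` set hs)"
  by (induction hs) (auto simp: pattern_fm_def)

text \<open>This is the finiteness of Hintikka types over a finite signature. Length 0 is decided by
  finitely many unnested atomic formulas in \<open>k\<close> variables; one more move is decided by
  stating, for each subset of the formulas for \<open>Suc k\<close> variables, whether some element
  realises exactly that subset.\<close>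

lemma hintikka_formulas:
  assumes fin: "finite Fs" "finite Rs" and Fs: "Fs \<subseteq> elts (fsyms L)" and Rs: "Rs \<subseteq> elts (rsyms L)"
  shows "\<exists>H. finite H \<and> (\<forall>p\<in>H. wf_fm L p \<and> fv p \<subseteq> {..<k}) \<and>
    (\<forall>P Q e e'. range e \<subseteq> elts (carr P) \<longrightarrow> range e' \<subseteq> elts (carr Q) \<longrightarrow>
       (\<forall>p\<in>H. sat P e p \<longleftrightarrow> sat Q e' p) \<longrightarrow>
       back_and_forth L Fs Rs n P Q ((\<lambda>i. (e i, e' i)) ` {..<k}))"
proof (induction n arbitrary: k)
  case 0
  define A where "A m = {is. set is \<subseteq> {..<k} \<and> length is = m}" for m
  have fA: "finite (A m)" for m unfolding A_def by (rule finite_lists_length_eq) simp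
  define H where "H = (\<lambda>(i, j). Eq (Var i) (Var j)) ` ({..<k} \<times> {..<k}) \<union>
    (\<Union>f\<in>Fs. (\<lambda>(is, j). Eq (App f (map Var is)) (Var j)) ` (A (farity L f) \<times> {..<k})) \<union>
    (\<Union>r\<in>Rs. (\<lambda>is. Rel r (map Var is)) ` A (rarity L r))"
  have "finite H" unfolding H_def using fin fA by simp
  moreover have "wf_fm L p \<and> fv p \<subseteq> {..<k}" if "p \<in> H" for p
    using that Fs Rs by (auto simp: H_def A_def list_all_iff)
  moreover have "back_and_forth L Fs Rs 0 P Q ((\<lambda>i. (e i, e' i)) ` {..<k})"
    if H: "\<forall>p\<in>H. sat P e p \<longleftrightarrow> sat Q e' p" for P Q :: "'a struc" and e e'
  proof -
    let ?\<rho> = "(\<lambda>i. (e i, e' i)) ` {..<k}"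
    have list: "\<exists>is\<in>A m. map fst ps = map e is \<and> map snd ps = map e' is"
      if "set ps \<subseteq> ?\<rho>" "length ps = m" for ps m
    proof -
      from that(1) have "ps \<in> lists ?\<rho>" by blast
      then obtain "is" where "is \<in> lists {..<k}" "ps = map (\<lambda>i. (e i, e' i)) is"
        unfolding lists_image by blast
      with that(2) show ?thesis by (intro bexI[of _ "is"]) (auto simp: A_def)
    qed
    have 1: "e i = e j \<longleftrightarrow> e' i = e' j" if "i < k" "j < k" for i j
    proof -
      have "Eq (Var i) (Var j) \<in> H" using that by (force simp: H_def)
      with H show ?thesis by fastforce
    qed
    have 2: "fn P f (map e is) = e j \<longleftrightarrow> fn Q f (map e' is) = e' j"
      if "f \<in> Fs" "is \<in> A (farity L f)" "j < k" for f "is" j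
    proof -
      have "Eq (App f (map Var is)) (Var j) \<in> H" using that by (force simp: H_def)
      with H have "sat P e (Eq (App f (map Var is)) (Var j)) \<longleftrightarrow> sat Q e' (Eq (App f (map Var is)) (Var j))" by blast
      then show ?thesis by (simp add: comp_def)
    qed
    have 3: "map e is \<in> rl P r \<longleftrightarrow> map e' is \<in> rl Q r"
      if "r \<in> Rs" "is \<in> A (rarity L r)" for r "is"
    proof -
      have "Rel r (map Var is) \<in> H" using that by (force simp: H_def)
      with H have "sat P e (Rel r (map Var is)) \<longleftrightarrow> sat Q e' (Rel r (map Var is))" by blast
      then show ?thesis by (simp add: comp_def)
    qed
    show ?thesis
      unfolding back_and_forth.simps partial_iso_def
    proof (intro conjI ballI allI impI)
      show "fst p = fst q \<longleftrightarrow> snd p = snd q" if "p \<in> ?\<rho>" "q \<in> ?\<rho>" for p q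
        using that 1 by auto
      show "fn P f (map fst ps) = fst q \<longleftrightarrow> fn Q f (map snd ps) = snd q"
        if f: "f \<in> Fs" and ps: "set ps \<subseteq> ?\<rho>" "length ps = farity L f" and q: "q \<in> ?\<rho>" for f ps q
      proof -
        obtain "is" where "is \<in> A (farity L f)" "map fst ps = map e is" "map snd ps = map e' is"
          using list[OF ps] by blast
        with 2[OF f] q show ?thesis by auto
      qed
      show "map fst ps \<in> rl P r \<longleftrightarrow> map snd ps \<in> rl Q r"
        if r: "r \<in> Rs" and ps: "set ps \<subseteq> ?\<rho>" "length ps = rarity L r" for r ps
      proof -
        obtain "is" where "is \<in> A (rarity L r)" "map fst ps = map e is" "map snd ps = map e' is"
          using list[OF ps] by blast
        with 3[OF r] show ?thesis by auto
      qed
    qed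
  qed
  ultimately show ?case by (intro exI[of _ H]) simp
next
  case (Suc n)
  obtain H0 where H0: "finite H0" "\<forall>p\<in>H0. wf_fm L p \<and> fv p \<subseteq> {..<k}"
    "\<And>P Q e e'. range e \<subseteq> elts (carr P) \<Longrightarrow> range e' \<subseteq> elts (carr Q) \<Longrightarrow>
       (\<forall>p\<in>H0. sat P e p \<longleftrightarrow> sat Q e' p) \<Longrightarrow> back_and_forth L Fs Rs n P Q ((\<lambda>i. (e i, e' i)) ` {..<k})"
    using Suc[of k] by auto
  obtain H1 where H1: "finite H1" "\<forall>p\<in>H1. wf_fm L p \<and> fv p \<subseteq> {..<Suc k}"
    "\<And>P Q e e'. range e \<subseteq> elts (carr P) \<Longrightarrow> range e' \<subseteq> elts (carr Q) \<Longrightarrow>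
       (\<forall>p\<in>H1. sat P e p \<longleftrightarrow> sat Q e' p) \<Longrightarrow> back_and_forth L Fs Rs n P Q ((\<lambda>i. (e i, e' i)) ` {..<Suc k})"
    using Suc[of "Suc k"] by auto
  obtain hs where hs: "set hs = H1" using finite_list[OF H1(1)] by blast
  define type_fm where "type_fm S = Ex k (pattern_fm (Eq (Var k) (Var k)) hs S)" for S
  \<comment> \<open>\<open>H0\<close> is kept for the clause of the game that demands a win in the
    shorter game from the same position.\<close>
  define H where "H = H0 \<union> type_fm ` Pow H1"
  have "finite H" using H0(1) H1(1) by (simp add: H_def)
  moreover have "wf_fm L p \<and> fv p \<subseteq> {..<k}" if "p \<in> H" for p
  proof -
    have "wf_fm L (type_fm S)" for S
      using H1(2) hs by (auto simp: type_fm_def intro!: wf_pattern_fm)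
    moreover have "fv (type_fm S) \<subseteq> {..<k}" for S
    proof
      fix x assume "x \<in> fv (type_fm S)"
      then have "x \<noteq> k" "x = k \<or> (\<exists>p\<in>H1. x \<in> fv p)" by (auto simp: type_fm_def fv_pattern_fm hs)
      then have "x \<noteq> k" "x < Suc k" using H1(2) by auto
      then show "x \<in> {..<k}" by simp
    qed
    ultimately show ?thesis using that H0(2) by (auto simp: H_def)
  qed
  moreover have "back_and_forth L Fs Rs (Suc n) P Q ((\<lambda>i. (e i, e' i)) ` {..<k})"
    if e: "range e \<subseteq> elts (carr P)" "range e' \<subseteq> elts (carr Q)"
      and H: "\<forall>p\<in>H. sat P e p \<longleftrightarrow> sat Q e' p" for P Q :: "'a struc" and e e'
  proof -
    have sat_type: "sat M d (type_fm S) \<longleftrightarrow>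
        (\<exists>a\<in>elts (carr M). \<forall>p\<in>H1. sat M (d(k := a)) p \<longleftrightarrow> p \<in> S)" for M :: "'a struc" and d S
      by (simp add: type_fm_def sat_pattern_fm hs)
    have types: "sat P e (type_fm S) \<longleftrightarrow> sat Q e' (type_fm S)" if "S \<subseteq> H1" for S
      using H that by (auto simp: H_def)
    have ins: "insert (a, b) ((\<lambda>i. (e i, e' i)) ` {..<k}) = (\<lambda>i. ((e(k := a)) i, (e'(k := b)) i)) ` {..<Suc k}" for a b
      by (auto simp: lessThan_Suc)
    have step: "back_and_forth L Fs Rs n P Q (insert (a, b) ((\<lambda>i. (e i, e' i)) ` {..<k}))"
      if "a \<in> elts (carr P)" "b \<in> elts (carr Q)" "\<forall>p\<in>H1. sat P (e(k := a)) p \<longleftrightarrow> sat Q (e'(k := b)) p" for a b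
      unfolding ins using that e by (intro H1(3)[of "e(k := a)" P "e'(k := b)" Q]) auto
    show ?thesis
      unfolding back_and_forth.simps
    proof (intro conjI ballI)
      show "back_and_forth L Fs Rs n P Q ((\<lambda>i. (e i, e' i)) ` {..<k})"
        using e H by (intro H0(3)) (auto simp: H_def)
    next
      fix a assume a: "a \<in> elts (carr P)"
      \<comment> \<open>The type of the chosen \<open>a\<close> over the position. Its realisability
        is a formula of \<open>H\<close>, hence transfers to \<open>Q\<close>, and any realisation
        there is a good answer.\<close>
      define S where "S = {p \<in> H1. sat P (e(k := a)) p}"
      have "sat P e (type_fm S)" using a by (auto simp: sat_type S_def)
      then have "sat Q e' (type_fm S)" using types[of S] by (auto simp: S_def)
      then obtain b where "b \<in> elts (carr Q)" "\<forall>p\<in>H1. sat Q (e'(k := b)) p \<longleftrightarrow> p \<in> S"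
        by (auto simp: sat_type)
      then show "\<exists>b\<in>elts (carr Q). back_and_forth L Fs Rs n P Q (insert (a, b) ((\<lambda>i. (e i, e' i)) ` {..<k}))"
        using a by (intro bexI[of _ b] step) (auto simp: S_def)
    next
      fix b assume b: "b \<in> elts (carr Q)"
      define S where "S = {p \<in> H1. sat Q (e'(k := b)) p}"
      have "sat Q e' (type_fm S)" using b by (auto simp: sat_type S_def)
      then have "sat P e (type_fm S)" using types[of S] by (auto simp: S_def)
      then obtain a where "a \<in> elts (carr P)" "\<forall>p\<in>H1. sat P (e(k := a)) p \<longleftrightarrow> p \<in> S"
        by (auto simp: sat_type)
      then show "\<exists>a\<in>elts (carr P). back_and_forth L Fs Rs n P Q (insert (a, b) ((\<lambda>i. (e i, e' i)) ` {..<k}))"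
        using b by (intro bexI[of _ a] step) (auto simp: S_def)
    qed
  qed
  ultimately show ?case by (intro exI[of _ H]) simp
qed

text \<open>The finitely many deciding formulas without free variables, with their truth values in
  \<open>P\<close>, form one sentence. If it failed throughout \<open>S\<close>, its negation would
  axiomatise an elementary class that contains \<open>S\<close> but not \<open>P\<close>.\<close>

lemma elementary_hull_back_and_forth:
  assumes S: "S \<subseteq> Collect (is_structure L)" and P: "P \<in> elementary_hull L S" "is_structure L P"
    and fin: "finite Fs" "finite Rs" and Fs: "Fs \<subseteq> elts (fsyms L)" and Rs: "Rs \<subseteq> elts (rsyms L)"
  shows "\<exists>Q\<in>S. back_and_forth L Fs Rs n P Q {}"
proof -
  obtain H where H: "finite H" "\<forall>p\<in>H. wf_fm L p \<and> fv p \<subseteq> {..<0}"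
    "\<And>P Q e e'. range e \<subseteq> elts (carr P) \<Longrightarrow> range e' \<subseteq> elts (carr Q) \<Longrightarrow>
       (\<forall>p\<in>H. sat P e p \<longleftrightarrow> sat Q e' p) \<Longrightarrow> back_and_forth L Fs Rs n P Q ((\<lambda>i. (e i, e' i)) ` {..<0})"
    using hintikka_formulas[OF fin Fs Rs, of 0 n] by auto
  obtain hs where hs: "set hs = H" using finite_list[OF H(1)] by blast
  obtain a where a: "a \<in> elts (carr P)" using is_structure_nonempty[OF P(2)] by blast
  define e where "e = (\<lambda>_::nat. a)"
  have e: "range e \<subseteq> elts (carr P)" using a by (simp add: e_def)
  \<comment> \<open>The starting conjunct is quantified, so that \<open>p\<close> has no free
    variables.\<close>
  define p where "p = pattern_fm (Ex 0 (Eq (Var 0) (Var 0))) hs {p \<in> H. sat P e p}"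
  have sp: "sat P e p" unfolding p_def sat_pattern_fm hs using a by auto
  have sent: "sentence L (Neg p)"
    using H(2) wf_pattern_fm[of L _ hs] by (auto simp: sentence_def p_def fv_pattern_fm hs intro!: wf_pattern_fm)
  have "\<not> S \<subseteq> Mod L {Neg p}"
  proof
    assume "S \<subseteq> Mod L {Neg p}"
    moreover have "elementary_class L (Mod L {Neg p})"
      unfolding elementary_class_def using sent by blast
    ultimately have "P \<in> Mod L {Neg p}" using elementary_hull_least P(1) by blast
    then have "models P (Neg p)" by (simp add: Mod_def)
    then have "sat P e (Neg p)" using e unfolding models_def by blast
    with sp show False by simp
  qed
  then obtain Q where Q: "Q \<in> S" "\<not> models Q (Neg p)" using S by (auto simp: Mod_def)
  then obtain e' where e': "range e' \<subseteq> elts (carr Q)" "sat Q e' p" by (auto simp: models_def)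
  then have "\<forall>p\<in>H. sat P e p \<longleftrightarrow> sat Q e' p" by (auto simp: p_def sat_pattern_fm hs)
  from H(3)[OF e e'(1) this] Q(1) show ?thesis by auto
qed

section \<open>Isomorphic ultraproducts\<close>

theorem ultrapower_isomorphic_ultraproduct:
  fixes L :: "'v::zf_universe signature"
  assumes S: "S \<subseteq> Collect (is_structure L)" and P: "P \<in> elementary_hull L S" "is_structure L P"
  shows "\<exists>I U Q. ultrafilter I U \<and> (\<forall>i. Q i \<in> S) \<and>
    isomorphic L (ultraproduct L I U (\<lambda>_. P)) (ultraproduct L I U Q)"
proof -
  \<comment> \<open>A kind of game is its length together with finite sets of function and relation
    symbols.\<close>
  define T where "T = (UNIV :: nat set) \<times> Fpow (elts (fsyms L)) \<times> Fpow (elts (rsyms L))"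
  define bf where "bf t = back_and_forth L (fst (snd t)) (snd (snd t)) (fst t)" for t :: "nat \<times> 'v set \<times> 'v set"
  have "\<exists>Q\<in>S. bf t P Q {}" if "t \<in> T" for t
    unfolding bf_def using that
    by (intro elementary_hull_back_and_forth[OF S P]) (auto simp: T_def Fpow_def)
  then obtain QT where QT: "\<And>t. t \<in> T \<Longrightarrow> QT t \<in> S" "\<And>t. t \<in> T \<Longrightarrow> bf t P (QT t) {}"
    by metis
  obtain x :: 'v where x: "infinite (elts x)" using infinity by blast
  \<comment> \<open>Adjoining \<open>x\<close> keeps everything infinite even if the signature is
    finite or empty.\<close>
  define w where "w = vset (elts x \<union> elts (fsyms L) \<union> elts (rsyms L))"
  have w: "elts w = elts x \<union> elts (fsyms L) \<union> elts (rsyms L)" by (simp add: w_def small_Un)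
  let ?W = "{y. elts y \<subseteq> elts w}"
  have PW: "Pow (elts w) \<lesssim> ?W" "?W \<lesssim> Pow (elts w)"
    using bij_betw_elts_Pow[of w] by (meson eqpoll_def eqpoll_imp_lepoll eqpoll_sym)+
  have infPw: "infinite (Pow (elts w))" using x by (simp add: w)
  have T_W: "T \<lesssim> ?W"
  proof -
    have "Fpow (elts (fsyms L)) \<lesssim> Pow (elts w)" "Fpow (elts (rsyms L)) \<lesssim> Pow (elts w)"
      by (auto simp: w Fpow_def intro!: subset_imp_lepoll)
    then have "T \<lesssim> Pow (elts w)"
      unfolding T_def using infPw infinite_le_lepoll[THEN iffD1, OF infPw] by (intro times_lepoll_infinite)
    then show ?thesis using PW(1) by (rule lepoll_trans)
  qed
  have smallW: "small ?W" by (simp add: small_Pow)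
  \<comment> \<open>\<open>K\<close> must be able to number the kinds of game as well as the
    elements of \<open>P\<close> and of every \<open>QT t\<close>. \<open>T\<close> lies outside the
    universe, but it is dominated by \<open>?W\<close>, so the carriers of all \<open>QT t\<close>
    still form a small family.\<close>
  define k where "k = vset (?W \<union> elts (carr P) \<union> (\<Union>c\<in>(\<lambda>t. carr (QT t)) ` T. elts c))"
  have "small ((\<lambda>t. carr (QT t)) ` T)"
    using lepoll_trans[OF image_lepoll T_W] smallW by (rule small_lepoll)
  then have k: "elts k = ?W \<union> elts (carr P) \<union> (\<Union>c\<in>(\<lambda>t. carr (QT t)) ` T. elts c)"
    unfolding k_def by (intro elts_vset_small small_Un small_UN smallW) auto
  define K where "K = elts k"
  have WK: "?W \<lesssim> K" unfolding K_def k by (rule subset_imp_lepoll) blast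
  have T_K: "T \<lesssim> K" using T_W WK by (rule lepoll_trans)
  have K: "infinite K"
    using infPw lepoll_trans[OF PW(1) WK] by (meson infinite_le_lepoll lepoll_trans)
  have carrP: "elts (carr P) \<lesssim> K" unfolding K_def k by (rule subset_imp_lepoll) blast
  have carrQ: "elts (carr (QT t)) \<lesssim> K" if "t \<in> T" for t
    unfolding K_def k using that by (intro subset_imp_lepoll) blast
  obtain ind :: "'v set set \<Rightarrow> 'v set \<Rightarrow> 'v" where
    ind: "\<And>D p. D \<subseteq> Pow (Pow K) \<Longrightarrow> D \<lesssim> K \<Longrightarrow> p \<in> D \<rightarrow> K \<Longrightarrow>
       \<exists>\<xi>\<in>Pow K. \<forall>X\<in>D. ind X \<xi> = p X"
    using independent_family[OF K] by blast
  define I where "I = vset {y. elts y \<subseteq> elts k}"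
  have I: "elts I = {y. elts y \<subseteq> K}" unfolding I_def K_def by (rule elts_powerset)
  have bijI: "bij_betw elts (elts I) (Pow K)"
    unfolding I unfolding K_def by (rule bij_betw_elts_Pow)
  then have IPow: "elts I \<approx> Pow K" by (auto simp: eqpoll_def)
  \<comment> \<open>Removing \<open>{}\<close> keeps the size of the supply and leaves the value of
    that function free to select the structure at an index.\<close>
  define J where "J = Pow (Pow K) - {{}}"
  have "infinite (Pow (Pow K))" using K by simp
  then have J: "infinite J" by (simp add: J_def)
  have PPJ: "Pow (Pow K) \<lesssim> J"
  proof -
    have "Pow (Pow K) \<subseteq> insert {} J" by (auto simp: J_def)
    then have "Pow (Pow K) \<lesssim> insert {} J" by (rule subset_imp_lepoll)
    also have "\<dots> \<lesssim> J" by (rule infinite_insert_lepoll[OF J])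
    finally show ?thesis .
  qed
  have KJ: "K \<prec> J"
    using lesspoll_trans2[OF lesspoll_trans[OF lesspoll_Pow_self lesspoll_Pow_self] PPJ] .
  have KI: "K \<lesssim> elts I" using lepoll_trans2[OF lepoll_Pow_self eqpoll_sym[OF IPow]] .
  have infI: "infinite (elts I)" using K IPow by (simp add: eqpoll_finite_iff[OF IPow])
  have PIJ: "Pow (elts I) \<lesssim> J"
    using Pow_lepoll_mono[OF eqpoll_imp_lepoll[OF IPow]] PPJ by (rule lepoll_trans)
  obtain dT where dT: "dT ` K = T" "range dT \<subseteq> T"
  proof -
    have "T \<noteq> {}" by (auto simp: T_def Fpow_def)
    from lepoll_imp_surj[OF T_K this] show ?thesis using that by blast
  qed
  txt \<open>The independent function with index \<open>{}\<close> is reserved for distributing the \<open>QT t\<close> over \<open>I\<close>.\<close>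
  define Q where "Q y = QT (dT (ind {} (elts y)))" for y
  have dTT: "dT v \<in> T" for v using dT(2) by blast
  have QS: "Q y \<in> S" for y unfolding Q_def by (rule QT(1)[OF dTT])
  then have Qs: "is_structure L (Q y)" for y using S by blast
  obtain dP where dP: "dP ` K = elts (carr P)" "range dP \<subseteq> elts (carr P)"
    using lepoll_imp_surj[OF carrP is_structure_nonempty[OF P(2)]] by blast
  have "\<exists>d. d ` K = elts (carr (Q y)) \<and> range d \<subseteq> elts (carr (Q y))" for y
    unfolding Q_def
    by (rule lepoll_imp_surj[OF carrQ[OF dTT] is_structure_nonempty[OF Qs[unfolded Q_def]]])
  then obtain dQ where dQ: "\<And>y. dQ y ` K = elts (carr (Q y))" "\<And>y. range (dQ y) \<subseteq> elts (carr (Q y))"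
    by metis
  \<comment> \<open>A task is an element of one of the two products, given as a choice function; the
    summand records on which side a partner is wanted.\<close>
  define Task where "Task = (elts I \<rightarrow>\<^sub>E elts (carr P)) <+> (\<Pi>\<^sub>E y\<in>elts I. elts (carr (Q y)))"
  define pr where "pr c v y = (case c of Inl a \<Rightarrow> (a y, dQ y v) | Inr b \<Rightarrow> (dP v, b y))"
    for c :: "('v \<Rightarrow> 'v) + ('v \<Rightarrow> 'v)" and v y
  have TaskJ: "Task \<lesssim> J"
    unfolding Task_def
  proof (rule infinite_Plus_lepoll[OF J])
    show "(elts I \<rightarrow>\<^sub>E elts (carr P)) \<lesssim> J"
      using PiE_lepoll_Pow[OF infI KI carrP] PIJ by (rule lepoll_trans)
    show "(\<Pi>\<^sub>E y\<in>elts I. elts (carr (Q y))) \<lesssim> J"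
      using PIJ by (rule lepoll_trans[rotated]) (rule PiE_lepoll_Pow[OF infI KI], unfold Q_def, rule carrQ[OF dTT])
  qed
  have "\<exists>j. \<forall>t\<in>T. \<forall>W. finite W \<longrightarrow> W \<subseteq> Task \<longrightarrow>
    (\<exists>y\<in>elts I. bf t P (Q y) ((\<lambda>c. pr c (ind (j c) (elts y)) y) ` W))"
  proof (rule back_and_forth_choice[where K = K and J = J and nx = "\<lambda>t. (Suc (fst t), snd t)"
        and ind = "\<lambda>X y. ind X (elts y)" and Ag = "\<lambda>t y. bf t P (Q y)", OF K T_K KJ TaskJ])
    show "(Suc (fst t), snd t) \<in> T" if "t \<in> T" for t using that by (auto simp: T_def)
    show "bf t P (Q y) \<rho>'" if "bf t P (Q y) \<rho>" "\<rho>' \<subseteq> \<rho>" for t y \<rho> \<rho>'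
      using that unfolding bf_def by (auto intro: back_and_forth_mono)
  next
    fix t D p assume *: "t \<in> T" "D \<subseteq> J" "D \<lesssim> K" "p \<in> D \<rightarrow> K"
    obtain v where v: "v \<in> K" "dT v = t" using *(1) dT(1) by blast
    have nD: "{} \<notin> D" using *(2) by (auto simp: J_def)
    \<comment> \<open>Prescribing a code of \<open>t\<close> at the reserved function forces
      \<open>Q y\<close> to be \<open>QT t\<close>, where the empty position wins; independence
      allows the values on \<open>D\<close> to be met at the same index.\<close>
    have "\<exists>\<xi>\<in>Pow K. \<forall>X\<in>insert {} D. ind X \<xi> = (p({} := v)) X"
    proof (rule ind)
      show "insert {} D \<subseteq> Pow (Pow K)" using *(2) by (auto simp: J_def)
      show "insert {} D \<lesssim> K"
        using Un_lepoll_infinite[OF K _ *(3), of "{{}}"] K by (simp add: finite_lepoll_infinite)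
      show "p({} := v) \<in> insert {} D \<rightarrow> K" using *(4) v(1) by auto
    qed
    then obtain \<xi> where \<xi>: "\<xi> \<in> Pow K" "ind {} \<xi> = v" "\<And>d. d \<in> D \<Longrightarrow> ind d \<xi> = p d"
      using nD by (auto split: if_splits)
    have "\<xi> \<in> elts ` elts I" using bijI \<xi>(1) by (simp add: bij_betw_def)
    then obtain y where y: "y \<in> elts I" "elts y = \<xi>" by blast
    then have "Q y = QT t" using \<xi>(2) v(2) by (simp add: Q_def)
    then show "\<exists>y\<in>elts I. bf t P (Q y) {} \<and> (\<forall>d\<in>D. ind d (elts y) = p d)"
      using y \<xi>(3) QT(2)[OF *(1)] by (intro bexI[of _ y]) simp_all
  next
    fix t y c \<rho> assume *: "t \<in> T" "y \<in> elts I" "c \<in> Task" "bf (Suc (fst t), snd t) P (Q y) \<rho>"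
    show "\<exists>v\<in>K. bf t P (Q y) (insert (pr c v y) \<rho>)"
    proof (cases c)
      case (Inl a)
      then have "a y \<in> elts (carr P)" using *(2,3) by (auto simp: Task_def)
      then obtain b where "b \<in> elts (carr (Q y))" "bf t P (Q y) (insert (a y, b) \<rho>)"
        using *(4) by (auto simp: bf_def)
      moreover from this(1) obtain v where "v \<in> K" "b = dQ y v" using dQ(1)[of y] by blast
      ultimately show ?thesis using Inl by (auto simp: pr_def)
    next
      case (Inr b)
      then have "b y \<in> elts (carr (Q y))" using *(2,3) by (auto simp: Task_def)
      then obtain a where "a \<in> elts (carr P)" "bf t P (Q y) (insert (a, b y) \<rho>)"
        using *(4) by (auto simp: bf_def)
      moreover from this(1) obtain v where "v \<in> K" "a = dP v" using dP(1) by blast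
      ultimately show ?thesis using Inr by (auto simp: pr_def)
    qed
  qed
  then obtain j where j: "\<And>t W. t \<in> T \<Longrightarrow> finite W \<Longrightarrow> W \<subseteq> Task \<Longrightarrow>
    \<exists>y\<in>elts I. bf t P (Q y) ((\<lambda>c. pr c (ind (j c) (elts y)) y) ` W)" by blast
  define pt where "pt c y = pr c (ind (j c) (elts y)) y" for c y
  define Y where "Y t W = {y \<in> elts I. bf t P (Q y) ((\<lambda>c. pt c y) ` W)}" for t W
  define E where "E = {Y t W |t W. t \<in> T \<and> finite W \<and> W \<subseteq> Task}"
  \<comment> \<open>A win in a longer game with more symbols and more pairs is a win in each smaller
    one, so the sets \<open>Y t W\<close> are directed downwards.\<close>
  have Y_Int: "Y (max n n', A \<union> A', B \<union> B') (W \<union> W') \<subseteq> Y (n, A, B) W \<inter> Y (n', A', B') W'"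
    for n n' A A' B B' W W'
  proof -
    have "Y (max n n', A \<union> A', B \<union> B') (W \<union> W') \<subseteq> Y (m, A'', B'') W''"
      if "m \<le> max n n'" "A'' \<subseteq> A \<union> A'" "B'' \<subseteq> B \<union> B'" "W'' \<subseteq> W \<union> W'" for m A'' B'' W''
      using back_and_forth_mono[OF back_and_forth_le[OF that(1)] image_mono[OF that(4)] that(2,3)]
      by (auto simp: Y_def bf_def)
    then show ?thesis by simp
  qed
  have E_dir: "\<exists>Z\<in>E. Z \<subseteq> \<Inter>G" if "finite G" "G \<subseteq> E" for G
    using that
  proof (induction G)
    case empty
    have "Y (0, {}, {}) {} \<in> E" unfolding E_def T_def Fpow_def by blast
    then show ?case by auto
  next
    case (insert X G)
    then obtain Z where Z: "Z \<in> E" "Z \<subseteq> \<Inter>G" by auto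
    obtain n A B W where 1: "X = Y (n, A, B) W" "(n, A, B) \<in> T" "finite W" "W \<subseteq> Task"
      using insert.prems by (auto simp: E_def)
    obtain n' A' B' W' where 2: "Z = Y (n', A', B') W'" "(n', A', B') \<in> T" "finite W'" "W' \<subseteq> Task"
      using Z(1) by (auto simp: E_def)
    have "(max n n', A \<union> A', B \<union> B') \<in> T" using 1(2) 2(2) by (auto simp: T_def Fpow_def)
    then have "Y (max n n', A \<union> A', B \<union> B') (W \<union> W') \<in> E"
      using 1(3,4) 2(3,4) unfolding E_def by blast
    moreover have "Y (max n n', A \<union> A', B \<union> B') (W \<union> W') \<subseteq> X \<inter> Z"
      unfolding 1(1) 2(1) by (rule Y_Int)
    ultimately show ?case using Z(2) by (intro bexI) auto
  qed
  have "\<exists>U. ultrafilter I U \<and> E \<subseteq> elts ` elts U"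
  proof (rule ultrafilter_extension)
    show "E \<subseteq> Pow (elts I)" by (auto simp: E_def Y_def)
    fix G assume "finite G" "G \<subseteq> E"
    then obtain Z where "Z \<in> E" "Z \<subseteq> \<Inter>G" using E_dir by blast
    moreover from this(1) have "Z \<noteq> {}" "Z \<subseteq> elts I" using j by (auto simp: E_def Y_def pt_def) blast
    ultimately show "elts I \<inter> \<Inter>G \<noteq> {}" by blast
  qed
  then obtain U where U: "ultrafilter I U" "E \<subseteq> elts ` elts U" by blast
  \<comment> \<open>Once the ultrafilter is fixed, games of length 0 suffice, since only atomic
    facts about the matched pairs are compared; the moves in reserve served the construction of
    \<open>j\<close>.\<close>
  have aeI: "ae I U (\<lambda>y. partial_iso L A B P (Q y) ((\<lambda>c. pt c y) ` W))"
    if "finite A" "finite B" "A \<subseteq> elts (fsyms L)" "B \<subseteq> elts (rsyms L)" "finite W" "W \<subseteq> Task" for A B W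
  proof -
    have "(0, A, B) \<in> T" using that by (auto simp: T_def Fpow_def)
    then have "Y (0, A, B) W \<in> E" using that(5,6) unfolding E_def by blast
    then show ?thesis using U(2) by (auto simp: ae_def Y_def bf_def)
  qed
  \<comment> \<open>Each task yields a pair of elements of the two direct products: one component is
    the element of the task, the other is the partner read off from \<open>j c\<close>.\<close>
  define vp where "vp c = (vfun I (\<lambda>y. fst (pt c y)), vfun I (\<lambda>y. snd (pt c y)))" for c
  define R where "R = vp ` Task"
  have vp: "vapp (fst (vp c)) y = fst (pt c y)" "vapp (snd (vp c)) y = snd (pt c y)" if "y \<in> elts I" for c y
    using that by (simp_all add: vp_def)
  have pt: "fst (pt c y) \<in> elts (carr P)" "snd (pt c y) \<in> elts (carr (Q y))" if "c \<in> Task" "y \<in> elts I" for c y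
    using that dP(2) dQ(2)[of y] by (auto simp: pt_def pr_def Task_def)
  have R_list: "\<exists>cs. set cs \<subseteq> Task \<and> ps = map vp cs" if "set ps \<subseteq> R" for ps
  proof -
    have "ps \<in> lists (vp ` Task)" using that by (auto simp: R_def)
    then show ?thesis unfolding lists_image by auto
  qed
  have "isomorphic L (ultraproduct L I U (\<lambda>_. P)) (ultraproduct L I U Q)"
  proof (rule ultraproducts_isomorphic[OF U(1)])
    show "R \<subseteq> elts (carr (product L I (\<lambda>_. P))) \<times> elts (carr (product L I Q))"
      using pt by (auto simp: R_def vp_def)
    show "\<exists>w. (z, w) \<in> R" if z: "z \<in> elts (carr (product L I (\<lambda>_. P)))" for z
    proof -
      obtain a where a: "z = vfun I a" "a \<in> elts I \<rightarrow>\<^sub>E elts (carr P)"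
        using z by (auto simp: elts_carr_product)
      then have "Inl a \<in> Task" by (auto simp: Task_def)
      moreover have "fst (vp (Inl a)) = z" by (simp add: vp_def pt_def pr_def a(1))
      ultimately show ?thesis unfolding R_def by (metis imageI prod.collapse)
    qed
    show "\<exists>z. (z, w) \<in> R" if w: "w \<in> elts (carr (product L I Q))" for w
    proof -
      obtain b where b: "w = vfun I b" "b \<in> (\<Pi>\<^sub>E y\<in>elts I. elts (carr (Q y)))"
        using w by (auto simp: elts_carr_product)
      then have "Inr b \<in> Task" by (auto simp: Task_def)
      moreover have "snd (vp (Inr b)) = w" by (simp add: vp_def pt_def pr_def b(1))
      ultimately show ?thesis unfolding R_def by (metis imageI prod.collapse)
    qed
    show "ae I U (\<lambda>y. vapp z y = vapp z' y \<longleftrightarrow> vapp w y = vapp w' y)"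
      if zw: "(z, w) \<in> R" "(z', w') \<in> R" for z w z' w'
    proof -
      obtain c c' where c: "c \<in> Task" "(z, w) = vp c" "c' \<in> Task" "(z', w') = vp c'"
        using zw by (auto simp: R_def)
      have "ae I U (\<lambda>y. partial_iso L {} {} P (Q y) ((\<lambda>c. pt c y) ` {c, c'}))"
        using c by (intro aeI) auto
      then show ?thesis
      proof (rule ae_mono[OF U(1)])
        fix y assume y: "y \<in> elts I" "partial_iso L {} {} P (Q y) ((\<lambda>c. pt c y) ` {c, c'})"
        then have "fst (pt c y) = fst (pt c' y) \<longleftrightarrow> snd (pt c y) = snd (pt c' y)"
          unfolding partial_iso_def by blast
        then show "vapp z y = vapp z' y \<longleftrightarrow> vapp w y = vapp w' y"
          using vp[OF y(1), of c] vp[OF y(1), of c'] c(2,4) by (metis fst_conv snd_conv)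
      qed
    qed
    show "ae I U (\<lambda>y. fn P f (map (\<lambda>p. vapp (fst p) y) ps) = vapp z y \<longleftrightarrow>
                  fn (Q y) f (map (\<lambda>p. vapp (snd p) y) ps) = vapp w y)"
      if f: "f \<in> elts (fsyms L)" and ps: "set ps \<subseteq> R" "length ps = farity L f" and zw: "(z, w) \<in> R" for f ps z w
    proof -
      obtain c where c: "c \<in> Task" "(z, w) = vp c" using zw by (auto simp: R_def)
      obtain cs where cs: "set cs \<subseteq> Task" "ps = map vp cs" using R_list[OF ps(1)] by blast
      have "ae I U (\<lambda>y. partial_iso L {f} {} P (Q y) ((\<lambda>c. pt c y) ` set (c # cs)))"
        using c cs f by (intro aeI) auto
      then show ?thesis
      proof (rule ae_mono[OF U(1)])
        fix y assume y: "y \<in> elts I" "partial_iso L {f} {} P (Q y) ((\<lambda>c. pt c y) ` set (c # cs))"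
        have "set (map (\<lambda>c. pt c y) cs) \<subseteq> (\<lambda>c. pt c y) ` set (c # cs)"
          "length (map (\<lambda>c. pt c y) cs) = farity L f" "pt c y \<in> (\<lambda>c. pt c y) ` set (c # cs)"
          using ps(2) cs(2) by auto
        then have "fn P f (map fst (map (\<lambda>c. pt c y) cs)) = fst (pt c y) \<longleftrightarrow>
            fn (Q y) f (map snd (map (\<lambda>c. pt c y) cs)) = snd (pt c y)"
          using y(2) unfolding partial_iso_def by blast
        moreover have "map (\<lambda>p. vapp (fst p) y) ps = map fst (map (\<lambda>c. pt c y) cs)"
          "map (\<lambda>p. vapp (snd p) y) ps = map snd (map (\<lambda>c. pt c y) cs)"
          using vp[OF y(1)] by (simp_all add: cs(2))
        moreover have "vapp z y = fst (pt c y)" "vapp w y = snd (pt c y)"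
          using vp[OF y(1), of c] c(2) by (metis fst_conv snd_conv)+
        ultimately show "fn P f (map (\<lambda>p. vapp (fst p) y) ps) = vapp z y \<longleftrightarrow>
                  fn (Q y) f (map (\<lambda>p. vapp (snd p) y) ps) = vapp w y" by (simp only:)
      qed
    qed
    show "ae I U (\<lambda>y. map (\<lambda>p. vapp (fst p) y) ps \<in> rl P r \<longleftrightarrow> map (\<lambda>p. vapp (snd p) y) ps \<in> rl (Q y) r)"
      if r: "r \<in> elts (rsyms L)" and ps: "set ps \<subseteq> R" "length ps = rarity L r" for r ps
    proof -
      obtain cs where cs: "set cs \<subseteq> Task" "ps = map vp cs" using R_list[OF ps(1)] by blast
      have "ae I U (\<lambda>y. partial_iso L {} {r} P (Q y) ((\<lambda>c. pt c y) ` set cs))"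
        using cs r by (intro aeI) auto
      then show ?thesis
      proof (rule ae_mono[OF U(1)])
        fix y assume y: "y \<in> elts I" "partial_iso L {} {r} P (Q y) ((\<lambda>c. pt c y) ` set cs)"
        have "set (map (\<lambda>c. pt c y) cs) \<subseteq> (\<lambda>c. pt c y) ` set cs"
          "length (map (\<lambda>c. pt c y) cs) = rarity L r"
          using ps(2) cs(2) by auto
        then have "map fst (map (\<lambda>c. pt c y) cs) \<in> rl P r \<longleftrightarrow> map snd (map (\<lambda>c. pt c y) cs) \<in> rl (Q y) r"
          using y(2) unfolding partial_iso_def by blast
        moreover have "map (\<lambda>p. vapp (fst p) y) ps = map fst (map (\<lambda>c. pt c y) cs)"
          "map (\<lambda>p. vapp (snd p) y) ps = map snd (map (\<lambda>c. pt c y) cs)"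
          using vp[OF y(1)] by (simp_all add: cs(2))
        ultimately show "map (\<lambda>p. vapp (fst p) y) ps \<in> rl P r \<longleftrightarrow> map (\<lambda>p. vapp (snd p) y) ps \<in> rl (Q y) r"
          by (simp only:)
      qed
    qed
  qed (use P(2) Qs in auto)
  with U(1) QS show ?thesis by blast
qed

section \<open>Equality of the generated varieties\<close>

lemma ultraproduct_closedD:
  assumes "ultraproduct_closed L K" "ultrafilter I U" "\<And>i. i \<in> elts I \<Longrightarrow> P i \<in> K"
  shows "ultraproduct L I U P \<in> K"
  using assms unfolding ultraproduct_closed_def by simp

lemma inj_hom_trans:
  assumes "algebraic F" "inj_hom F A B" "inj_hom F B C"
  shows "inj_hom F A C"
proof -
  obtain g h where g: "g \<in> hom F A B" "inj_on g (elts (carr A))" and h: "h \<in> hom F B C" "inj_on h (elts (carr B))"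
    using assms(2,3) by (auto simp: inj_hom_def)
  have "h \<circ> g \<in> hom F A C"
    unfolding hom_def
  proof (intro CollectI conjI ballI)
    show "h \<circ> g \<in> elts (carr A) \<rightarrow> elts (carr C)" using homD(1)[OF g(1)] homD(1)[OF h(1)] by auto
    show "(h \<circ> g) (fn A f xs) = fn C f (map (h \<circ> g) xs)"
      if f: "f \<in> elts (fsyms F)" and xs: "xs \<in> tuples (carr A) (farity F f)" for f xs
    proof -
      have "map g xs \<in> tuples (carr B) (farity F f)" using xs homD(1)[OF g(1)] by (auto simp: tuples_def)
      then show ?thesis using homD(2)[OF g(1) f xs] homD(2)[OF h(1) f] by simp
    qed
  qed (use assms(1) in \<open>simp add: algebraic_def\<close>)
  moreover have "inj_on (h \<circ> g) (elts (carr A))"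
    using g(2) h(2) homD(1)[OF g(1)] by (intro comp_inj_on inj_on_subset[OF h(2)]) auto
  ultimately show ?thesis unfolding inj_hom_def by blast
qed

theorem theorem7p3:
  fixes L F :: "'v::zf_universe signature"
    and Sig S C :: "'v struc set"
    and sigma plus :: "'v struc \<Rightarrow> 'v struc"
  assumes "canonicity_framework L Sig F C sigma plus"
    and "S \<subseteq> Sig"
    and "ultraproduct_closed L S"
    and "elementary_hull L S \<subseteq> Sig"
    and "\<And>P Q. P \<in> Sig \<Longrightarrow> Q \<in> Sig \<Longrightarrow> isomorphic L P Q \<Longrightarrow> isomorphic F (plus P) (plus Q)"
  shows "HSP F (plus ` S) = HSP F (plus ` elementary_hull L S)"
proof
  interpret canonicity_framework L Sig F C sigma plus by (rule assms(1))
  show "HSP F (plus ` S) \<subseteq> HSP F (plus ` elementary_hull L S)"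
    by (intro HSP_mono image_mono elementary_hull_subset)
  have F: "algebraic F" and C: "C \<subseteq> Collect (is_structure F)" using C_variety by (auto simp: variety_def)
  have plus: "plus P \<in> C" "is_structure F (plus P)" if "P \<in> Sig" for P
    using that plus_closed C by auto
  show "HSP F (plus ` elementary_hull L S) \<subseteq> HSP F (plus ` S)"
  proof (rule HSP_subset_if_embeds[OF F])
    show "plus ` S \<subseteq> Collect (is_structure F)" using plus assms(2) by auto
    fix A assume "A \<in> plus ` elementary_hull L S"
    then obtain P where P: "P \<in> elementary_hull L S" "A = plus P" by blast
    then have PSig: "P \<in> Sig" using assms(4) by blast
    then have "is_structure L P" "S \<subseteq> Collect (is_structure L)" using Sig_structures assms(2) by auto
    from ultrapower_isomorphic_ultraproduct[OF this(2) P(1) this(1)]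
    obtain I U Q where U: "ultrafilter I U" and Q: "\<forall>i. Q i \<in> S"
      and iso: "isomorphic L (ultraproduct L I U (\<lambda>_. P)) (ultraproduct L I U Q)" by blast
    \<comment> \<open>Here closure of \<open>S\<close> under ultraproducts brings the target of the
      embedding back into \<open>S\<close>.\<close>
    have QS: "ultraproduct L I U Q \<in> S" by (rule ultraproduct_closedD[OF assms(3) U]) (use Q in blast)
    \<comment> \<open>Isomorphisms are transferred to algebras only within \<open>Sig\<close>. The
      ultrapower lies there by closure of \<open>Sig\<close>, the ultraproduct because
      \<open>S \<subseteq> Sig\<close>.\<close>
    have "ultraproduct L I U (\<lambda>_. P) \<in> Sig"
      by (rule ultraproduct_closedD[OF Sig_ultraproducts U PSig])
    then have "isomorphic F (plus (ultraproduct L I U (\<lambda>_. P))) (plus (ultraproduct L I U Q))"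
      using QS assms(2) iso by (intro assms(5)) auto
    then have "inj_hom F (plus (ultraproduct L I U (\<lambda>_. P))) (plus (ultraproduct L I U Q))"
      by (auto simp: isomorphic_def inj_hom_def bij_betw_def)
    moreover have "inj_hom F (plus P) (ultraproduct F I U (\<lambda>_. plus P))"
      by (rule inj_hom_ultrapower[OF F U plus(2)[OF PSig]])
    moreover have "inj_hom F (ultraproduct F I U (\<lambda>_. plus P)) (plus (ultraproduct L I U (\<lambda>_. P)))"
      using A2[of I "\<lambda>_. P" U] PSig U by simp
    ultimately have "inj_hom F A (plus (ultraproduct L I U Q))"
      unfolding P(2) by (meson inj_hom_trans[OF F])
    with QS show "\<exists>B\<in>plus ` S. inj_hom F A B" by blast
  qed
qed

end
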